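(* Let $q>7$. In $\mathrm{PG}(2,q^2)$ let $\mathcal B$ be a Baer subplane tangent to $\ell_\infty$ at $\bar T=\mathcal B\cap\ell_\infty$, and let $\mathcal C$ be an $\mathbb F_q$-conic in $\mathcal B$ with $\bar T\notin\mathcal C$. Then in $\mathrm{PG}(4,q)$, $[\mathcal C]$ is a $4$-dimensional normal rational curve disjoint from $\Sigma_\infty$ which is $g$-special or $g^{\star\star}$-special.
   Context: Bruck–Bose setting: $\Sigma_\infty$ a hyperplane of $\mathrm{PG}(4,q)$ with regular spread $\mathcal S$; affine points $A$ of $\mathrm{PG}(2,q^2)$ correspond to points $[A]$ of $\mathrm{PG}(4,q)\setminus\Sigma_\infty$, points $\bar T\in\ell_\infty$ to spread lines $[T]$. In $\mathrm{PG}(4,q^2)$ the transversals of $\mathcal S$ are the conjugate lines $g,g^q$ (conjugation $X\mapsto X^q$ on coordinates) with $[T]^\star=TT^q$, $T=[T]^\star\cap g$; $g^{\star\star}$ denotes the extension of $g$ to a line of $\mathrm{PG}(4,q^4)$. An $\mathbb F_q$-conic is a non-degenerate conic of a Baer subplane of $\mathrm{PG}(2,q^2)$. For $\mathcal C$ as in the statement, $[\mathcal C]=\{[X]:X\in\mathcal C\}$ (all points of $\mathcal C$ are affine). For a $4$-dimensional normal rational curve $\mathcal N$ of $\mathrm{PG}(4,q)$ (image under a homography of $\{(1,\theta,\dots,\theta^4)\}$), $\mathcal N^\star$, $\mathcal N^{\star\star}$ are its extensions to $\mathrm{PG}(4,q^2)$, $\mathrm{PG}(4,q^4)$ (parameter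 ranging over the larger field). $\mathcal N$ is $g$-special if the four points (counted with multiplicity) of $\mathcal N^\star\cap\Sigma_\infty^\star$ are two points of $g$ (possibly a repeated point) and two points of $g^q$; $\mathcal N$ is $g^{\star\star}$-special if $\mathcal N^{\star\star}$ contains two points of $g^{\star\star}\setminus g$. *)

theory Defs
  imports "HOL-Analysis.Analysis" "HOL-Computational_Algebra.Polynomial"
begin

text \<open>Everything lives inside a finite field 'a of order q^4 (i.e. F_{q^4}).
  F_q and F_{q^2} are its subfields {x. x^q = x} and {x. x^(q^2) = x}.\<close>

definition Fq :: "nat \<Rightarrow> 'a::{field,finite} set" where
  "Fq q = {x. x ^ q = x}"

definition Fq2 :: "nat \<Rightarrow> 'a::{field,finite} set" where
  "Fq2 q = {x. x ^ (q^2) = x}"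

text \<open>Projective points are represented as one-dimensional subspaces of 'a^n
  (over the big field F_{q^4}); so PG(n,q) \<subseteq> PG(n,q^2) \<subseteq> PG(n,q^4) naturally.\<close>

definition pt :: "'a::field^'n \<Rightarrow> ('a^'n) set" where
  "pt v = range (\<lambda>c. c *s v)"

definition over :: "'a set \<Rightarrow> 'a^'n \<Rightarrow> bool" where
  "over K v \<longleftrightarrow> (\<forall>i. v $ i \<in> K)"

definition mat_over :: "'a set \<Rightarrow> 'a^'n^'m \<Rightarrow> bool" where
  "mat_over K M \<longleftrightarrow> (\<forall>i j. M $ i $ j \<in> K)"

definition PG :: "'a::field set \<Rightarrow> ('a^'n) set set" where
  "PG K = {pt v | v. v \<noteq> 0 \<and> over K v}"

definition line_inf :: "nat \<Rightarrow> ('a::{field,finite}^3) set set" where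
  "line_inf q = {P \<in> PG (Fq2 q). \<exists>v. P = pt v \<and> v $ 2 = 0}"

definition baer_img :: "nat \<Rightarrow> 'a::{field,finite}^3^3 \<Rightarrow> ('a^3) set set" where
  "baer_img q M = {pt (M *v v) | v. v \<noteq> 0 \<and> over (Fq q) v}"

definition baer_subplane :: "nat \<Rightarrow> ('a::{field,finite}^3) set set \<Rightarrow> bool" where
  "baer_subplane q B \<longleftrightarrow> (\<exists>M. mat_over (Fq2 q) M \<and> det M \<noteq> 0 \<and> B = baer_img q M)"

text \<open>Ternary quadratic form a x^2 + b y^2 + c z^2 + d xy + e xz + f yz, and its
  (characteristic-free) discriminant; non-degenerate iff the discriminant is nonzero.\<close>
definition qform :: "'a::field \<Rightarrow> 'a \<Rightarrow> 'a \<Rightarrow> 'a \<Rightarrow> 'a \<Rightarrow> 'a \<Rightarrow> 'a^3 \<Rightarrow> 'a" where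
  "qform a b c d e f v = a * (v$0)^2 + b * (v$1)^2 + c * (v$2)^2
      + d * v$0 * v$1 + e * v$0 * v$2 + f * v$1 * v$2"

definition qdisc :: "'a::field \<Rightarrow> 'a \<Rightarrow> 'a \<Rightarrow> 'a \<Rightarrow> 'a \<Rightarrow> 'a \<Rightarrow> 'a" where
  "qdisc a b c d e f = 4 * a * b * c + d * e * f - a * f^2 - b * e^2 - c * d^2"

definition Fq_conic :: "nat \<Rightarrow> ('a::{field,finite}^3) set set \<Rightarrow> ('a^3) set set \<Rightarrow> bool" where
  "Fq_conic q C B \<longleftrightarrow> (\<exists>M a b c d e f. mat_over (Fq2 q) M \<and> det M \<noteq> 0 \<and> B = baer_img q M
      \<and> {a,b,c,d,e,f} \<subseteq> Fq q \<and> qdisc a b c d e f \<noteq> 0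
      \<and> C = {pt (M *v v) | v. v \<noteq> 0 \<and> over (Fq q) v \<and> qform a b c d e f v = 0})"

definition vec5 :: "'a::zero \<Rightarrow> 'a \<Rightarrow> 'a \<Rightarrow> 'a \<Rightarrow> 'a \<Rightarrow> 'a^5" where
  "vec5 a b c d e = (\<chi> i. if i = 0 then a else if i = 1 then b else if i = 2 then c
                          else if i = 3 then d else e)"

text \<open>With a fixed tau \<in> F_{q^2} \ F_q (basis 1, tau of F_{q^2} over F_q), the affine point
  (x0 + x1 tau, y0 + y1 tau, 1) of PG(2,q^2) corresponds to (x0,x1,y0,y1,1) of PG(4,q);
  Sigma_inf is x4 = 0 and the spread line of (a,b,0) consists of the points (x0,x1,y0,y1,0)
  with (x0 + x1 tau, y0 + y1 tau) in the F_{q^2}-span of (a,b) (a regular spread).\<close>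
definition bb_rel :: "nat \<Rightarrow> 'a::{field,finite} \<Rightarrow> ('a^3) set \<Rightarrow> ('a^5) set \<Rightarrow> bool" where
  "bb_rel q \<tau> P R \<longleftrightarrow> (\<exists>v x0 x1 y0 y1. P = pt v \<and> v $ 2 = 1 \<and> {x0,x1,y0,y1} \<subseteq> Fq q
      \<and> v $ 0 = x0 + x1 * \<tau> \<and> v $ 1 = y0 + y1 * \<tau> \<and> R = pt (vec5 x0 x1 y0 y1 1))"

definition bb_image :: "nat \<Rightarrow> 'a::{field,finite} \<Rightarrow> ('a^3) set set \<Rightarrow> ('a^5) set set" where
  "bb_image q \<tau> C = {R. \<exists>P\<in>C. bb_rel q \<tau> P R}"

definition sigma_inf :: "'a::{field,finite} set \<Rightarrow> ('a^5) set set" where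
  "sigma_inf K = {P \<in> PG K. \<exists>v. P = pt v \<and> v $ 4 = 0}"

text \<open>The two transversal lines of the spread, in PG(4,K) (K = F_{q^2} gives g, g^q;
  K = UNIV = F_{q^4} gives their extensions g**, (g^q)**).
  g: x0 + x1 tau^q = 0, y0 + y1 tau^q = 0, x4 = 0;   g^q: same with tau.\<close>
definition transv :: "'a::{field,finite} set \<Rightarrow> 'a \<Rightarrow> ('a^5) set set" where
  "transv K t = {P \<in> PG K. \<exists>v. P = pt v \<and> v $ 4 = 0 \<and> v $ 0 + v $ 1 * t = 0
                         \<and> v $ 2 + v $ 3 * t = 0}"

definition g_line :: "nat \<Rightarrow> 'a::{field,finite} \<Rightarrow> ('a^5) set set" where
  "g_line q \<tau> = transv (Fq2 q) (\<tau> ^ q)"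

definition gq_line :: "nat \<Rightarrow> 'a::{field,finite} \<Rightarrow> ('a^5) set set" where
  "gq_line q \<tau> = transv (Fq2 q) \<tau>"

definition g_ext :: "nat \<Rightarrow> 'a::{field,finite} \<Rightarrow> ('a^5) set set" where
  "g_ext q \<tau> = transv UNIV (\<tau> ^ q)"

definition nu :: "'a::field \<Rightarrow> 'a^5" where
  "nu t = vec5 1 t (t^2) (t^3) (t^4)"

definition nu_inf :: "'a::field^5" where
  "nu_inf = vec5 0 0 0 0 1"

text \<open>Points of the curve with homography matrix M, parameter ranging over K \<union> {\<infinity>}:
  K = F_q gives N, K = F_{q^2} gives N*, K = UNIV (= F_{q^4}) gives N**.\<close>
definition nrc_pts :: "'a::{field,finite}^5^5 \<Rightarrow> 'a set \<Rightarrow> ('a^5) set set" where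
  "nrc_pts M K = {pt (M *v nu t) | t. t \<in> K} \<union> {pt (M *v nu_inf)}"

definition is_nrc_matrix :: "nat \<Rightarrow> 'a::{field,finite}^5^5 \<Rightarrow> bool" where
  "is_nrc_matrix q M \<longleftrightarrow> mat_over (Fq q) M \<and> det M \<noteq> 0"

text \<open>Polynomial in the parameter whose roots give the intersection with x4 = 0;
  the point at parameter \<infinity> is counted with multiplicity 4 - degree.\<close>
definition hpoly :: "'a::{field,finite}^5^5 \<Rightarrow> 'a poly" where
  "hpoly M = [: M$4$0, M$4$1, M$4$2, M$4$3, M$4$4 :]"

definition int_mult :: "nat \<Rightarrow> 'a::{field,finite}^5^5 \<Rightarrow> ('a^5) set set \<Rightarrow> nat" where
  "int_mult q M L =
     (\<Sum>t\<in>{t. t \<in> Fq2 q \<and> poly (hpoly M) t = 0 \<and> pt (M *v nu t) \<in> L}. order t (hpoly M))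
     + (if pt (M *v nu_inf) \<in> L then 4 - degree (hpoly M) else 0)"

definition g_special :: "nat \<Rightarrow> 'a::{field,finite} \<Rightarrow> 'a^5^5 \<Rightarrow> bool" where
  "g_special q \<tau> M \<longleftrightarrow> int_mult q M (g_line q \<tau>) = 2 \<and> int_mult q M (gq_line q \<tau>) = 2"

definition gss_special :: "nat \<Rightarrow> 'a::{field,finite} \<Rightarrow> 'a^5^5 \<Rightarrow> bool" where
  "gss_special q \<tau> M \<longleftrightarrow> (\<exists>P1 P2. P1 \<noteq> P2 \<and> P1 \<in> nrc_pts M UNIV \<and> P2 \<in> nrc_pts M UNIV
      \<and> P1 \<in> g_ext q \<tau> - g_line q \<tau> \<and> P2 \<in> g_ext q \<tau> - g_line q \<tau>)"

end

theory Submission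
  imports Defs "HOL-Algebra.Sylow" "HOL-Algebra.Algebraic_Closure_Type"
begin

text \<open>
  Parametrise the conic over \<open>F_q\<close> by quadratic forms; in \<open>PG(2,q^2)\<close> its points become
  \<open>(a(\<theta>), b(\<theta>), l(\<theta>))\<close> with quadratic \<open>a, b, l\<close> over \<open>F_{q^2}\<close>. Write \<open>l'\<close> for the conjugate of
  \<open>l\<close>. Multiplying by \<open>l'\<close> makes the last coordinate the quartic \<open>l l'\<close> over \<open>F_q\<close>, and splitting \<open>a l'\<close>
  and \<open>b l'\<close> along the basis \<open>1, \<tau>\<close> yields five quartics over \<open>F_q\<close>, the coordinates of \<open>[C]\<close>.
  A common zero of \<open>l\<close> and \<open>l'\<close> would put the point of tangency on the conic, so \<open>l\<close> and \<open>l'\<close> are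
  coprime; this makes the five quartics linearly independent. At a root of \<open>l\<close> the curve meets the
  transversal \<open>g\<close>, at a root of \<open>l'\<close> its conjugate. If \<open>l\<close> splits over \<open>F_{q^2}\<close> the curve is \<open>g\<close>-special,
  otherwise the two roots of \<open>l\<close> lie in \<open>F_{q^4}\<close> and the curve is special for the extension of \<open>g\<close>.
\<close>

no_notation Embedded_Algebras.over (infixl \<open>over\<close> 65)
  and Polynomials.var (\<open>X\<index>\<close>)
  and fps_nth (infixl \<open>$\<close> 75)
hide_const (open) Divisibility.prime Coset.order Embedded_Algebras.over
  module.smult up_ring.monom up_ring.coeff Polynomials.degree

section \<open>The tower of finite fields\<close>

text \<open>Multiplication by a nonzero \<open>x\<close> permutes the nonzero elements; comparing
  their product before and after leaves \<open>x ^ (CARD('a) - 1) = 1\<close>.\<close>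

lemma finite_field_power_card:
  fixes x :: "'a::{field,finite}"
  shows "x ^ CARD('a) = x"
proof (cases "x = 0")
  case False
  have "(\<Prod>y\<in>UNIV - {0}. x * y) = (\<Prod>y\<in>UNIV - {0}. y)"
    by (rule prod.reindex_bij_witness[of _ "\<lambda>y. y / x" "\<lambda>y. x * y"]) (use False in auto)
  then have "x ^ (CARD('a) - 1) = 1"
    by (simp add: prod.distrib card_Diff_singleton)
  moreover have "x ^ CARD('a) = x * x ^ (CARD('a) - 1)"
    by (metis Suc_diff_1 power_Suc zero_less_card_finite)
  ultimately show ?thesis by simp
qed auto

lemma prime_CHAR_finite_field: "prime CHAR('a::{field,finite})"
  using prime_CHAR_semidom[where ?'a = 'a] finite_imp_CHAR_pos[where ?'a = 'a] by simp

text \<open>Sylow's theorem gives an additive subgroup of order \<open>r\<close>; a nonzero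
  \<open>x\<close> in it satisfies \<open>r * x = 0\<close>, so the characteristic divides
  \<open>r\<close>.\<close>

lemma prime_dvd_card_finite_field:
  assumes r: "prime r" and dvd: "r dvd CARD('a::{field,finite})"
  shows "r = CHAR('a)"
proof -
  define G where "G = \<lparr>carrier = UNIV :: 'a set, monoid.mult = (+), one = (0 :: 'a)\<rparr>"
  interpret G: group G
    by (rule groupI) (auto simp: G_def add.assoc intro: exI[of _ "- x" for x])
  have pow: "x [^]\<^bsub>G\<^esub> n = of_nat n * x" for x :: 'a and n :: nat
    by (induction n) (simp_all add: G_def distrib_right add.commute)
  obtain m where m: "CARD('a) = r ^ 1 * m" using dvd by auto
  have "Coset.order G = r ^ 1 * m" using m by (simp add: Coset.order_def G_def)
  with sylow_thm[OF r G.is_group, of 1 m] obtain H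
    where H: "subgroup H G" "card H = r ^ 1" by (auto simp: G_def)
  interpret H: group "G\<lparr>carrier := H\<rparr>" using G.subgroup_imp_group[OF H(1)] .
  have "H \<noteq> {0}" using H(2) prime_gt_1_nat[OF r] by auto
  moreover have "0 \<in> H" using subgroup.one_closed[OF H(1)] by (simp add: G_def)
  ultimately obtain x where x: "x \<in> H" "x \<noteq> 0" by auto
  have "x [^]\<^bsub>G\<lparr>carrier := H\<rparr>\<^esub> Coset.order (G\<lparr>carrier := H\<rparr>) = \<one>\<^bsub>G\<^esub>"
    using H.pow_order_eq_1[of x] x(1) by (simp add: G_def)
  then have "of_nat r * x = 0"
    using H(2) pow by (simp add: Coset.order_def G.nat_pow_consistent[symmetric]) (simp add: G_def)
  then have "CHAR('a) dvd r" using x(2) by (simp add: of_nat_eq_0_iff_char_dvd)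
  then show ?thesis
    using prime_CHAR_finite_field[where ?'a = 'a] primes_dvd_imp_eq[of "CHAR('a)" r] r by auto
qed

lemma unique_prime_factor_imp_power:
  fixes p n :: nat
  assumes "n > 0" "\<And>r. prime r \<Longrightarrow> r dvd n \<Longrightarrow> r = p"
  shows "\<exists>k. n = p ^ k"
  using assms
proof (induction n rule: less_induct)
  case (less n)
  show ?case
  proof (cases "n = 1")
    case True
    then show ?thesis by (intro exI[of _ 0]) simp
  next
    case False
    then obtain r where r: "prime r" "r dvd n" by (meson prime_factor_nat)
    then have p: "prime p" "p dvd n" using less.prems(2) by metis+
    then obtain m where m: "n = p * m" by blast
    have "m < n" "m > 0" using m less.prems(1) prime_gt_1_nat[OF p(1)] by auto
    then obtain k where "m = p ^ k" using less.IH[of m] less.prems(2) m by auto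
    then show ?thesis using m by (intro exI[of _ "Suc k"]) simp
  qed
qed

locale fq_tower =
  fixes q :: nat and \<tau> :: "'a::{field,finite}"
  assumes card_eq: "CARD('a) = q ^ 4" and q_gt_1: "q > 1"
    and tau: "\<tau> \<in> Fq2 q - Fq q"
begin

text \<open>Every prime factor of \<open>q\<close> divides \<open>CARD('a) = q ^ 4\<close>, hence is
  the characteristic. This is what makes the map sending \<open>x\<close> to \<open>x ^ q\<close>
  additive.\<close>

lemma q_power: "\<exists>k. q = CHAR('a) ^ k"
proof (rule unique_prime_factor_imp_power)
  show "q > 0" using q_gt_1 by simp
  fix r assume "prime r" "r dvd q"
  then show "r = CHAR('a)"
    using prime_dvd_card_finite_field[of r, where ?'a = 'a] by (simp add: card_eq dvd_power_le numeral_eq_Suc)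
qed

lemma frob_add: "(x + y :: 'a) ^ q = x ^ q + y ^ q"
  using q_power freshmans_dream'[OF prime_CHAR_finite_field] by blast

lemma frob_mult: "(x * y :: 'a) ^ q = x ^ q * y ^ q"
  by (rule power_mult_distrib)

lemma frob_diff: "(x - y :: 'a) ^ q = x ^ q - y ^ q"
  using frob_add[of "x - y" y] by (simp add: algebra_simps)

lemma frob_0 [simp]: "(0::'a) ^ q = 0"
  using q_gt_1 by simp

lemma frob_minus: "(- x :: 'a) ^ q = - (x ^ q)"
  using frob_diff[of 0 x] by simp

lemma frob_divide: "(x / y :: 'a) ^ q = x ^ q / y ^ q"
  by (rule power_divide)

lemmas frob_simps = frob_add frob_mult frob_diff frob_minus frob_divide

lemma Fq2_iff: "(x::'a) \<in> Fq2 q \<longleftrightarrow> (x ^ q) ^ q = x"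
  by (simp add: Fq2_def power2_eq_square flip: power_mult)

lemma Fq_iff: "(x::'a) \<in> Fq q \<longleftrightarrow> x ^ q = x"
  by (simp add: Fq_def)

lemma Fq_Fq2: "(x::'a) \<in> Fq q \<Longrightarrow> x \<in> Fq2 q"
  by (simp add: Fq2_iff Fq_iff)

lemma Fq_0 [simp]: "(0::'a) \<in> Fq q" and Fq_1 [simp]: "(1::'a) \<in> Fq q"
  by (simp_all add: Fq_iff)

lemma Fq_closed:
  assumes "(x::'a) \<in> Fq q" "(y::'a) \<in> Fq q"
  shows "x + y \<in> Fq q" "x * y \<in> Fq q" "x - y \<in> Fq q" "x / y \<in> Fq q"
  using assms by (auto simp: Fq_iff frob_simps)

lemma Fq_minus: "(x::'a) \<in> Fq q \<Longrightarrow> - x \<in> Fq q"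
  by (simp add: Fq_iff frob_minus)

lemma Fq_power: "(x::'a) \<in> Fq q \<Longrightarrow> x ^ n \<in> Fq q"
  by (induction n) (auto intro: Fq_closed)

lemma Fq_numeral: "(numeral n :: 'a) \<in> Fq q"
  by (induction n) (simp_all only: numeral.simps Fq_1 Fq_closed)

lemmas Fq_intros = Fq_closed Fq_minus Fq_power Fq_numeral Fq_0 Fq_1

lemma Fq2_closed:
  assumes "(x::'a) \<in> Fq2 q" "(y::'a) \<in> Fq2 q"
  shows "x + y \<in> Fq2 q" "x * y \<in> Fq2 q" "x - y \<in> Fq2 q" "x / y \<in> Fq2 q"
  using assms by (auto simp: Fq2_iff frob_simps)

lemma Fq2_minus: "(x::'a) \<in> Fq2 q \<Longrightarrow> - x \<in> Fq2 q"
  by (simp add: Fq2_iff frob_minus)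

lemma Fq2_frob: "(x::'a) \<in> Fq2 q \<Longrightarrow> x ^ q \<in> Fq2 q"
  by (simp add: Fq2_iff)

lemma Fq2_power: "(x::'a) \<in> Fq2 q \<Longrightarrow> x ^ n \<in> Fq2 q"
  by (induction n) (auto intro: Fq2_closed simp: Fq_Fq2)

lemma Fq2_0 [simp]: "(0::'a) \<in> Fq2 q" and Fq2_1 [simp]: "(1::'a) \<in> Fq2 q"
  by (simp_all add: Fq_Fq2)

lemmas Fq2_intros = Fq2_closed Fq2_minus Fq2_power Fq2_0 Fq2_1

lemma tau_q: "\<tau> ^ q \<noteq> \<tau>" "(\<tau> ^ q) ^ q = \<tau>"
  using tau by (auto simp: Fq_iff Fq2_iff)

text \<open>Coordinates with respect to the basis \<open>1, \<tau>\<close> of \<open>Fq2\<close> over \<open>Fq\<close>.\<close>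

definition snd_coord :: "'a \<Rightarrow> 'a" where
  "snd_coord x = (x - x ^ q) / (\<tau> - \<tau> ^ q)"

definition fst_coord :: "'a \<Rightarrow> 'a" where
  "fst_coord x = x - snd_coord x * \<tau>"

lemma coord_sum: "fst_coord x + snd_coord x * \<tau> = x"
  by (simp add: fst_coord_def)

lemma coord_sum_conj: "fst_coord x + snd_coord x * \<tau> ^ q = x ^ q"
proof -
  have "snd_coord x * (\<tau> - \<tau> ^ q) = x - x ^ q" using tau_q by (simp add: snd_coord_def)
  then show ?thesis by (simp add: fst_coord_def algebra_simps)
qed

text \<open>Conjugation negates both numerator and denominator of \<open>snd_coord x\<close>, so it
  fixes the quotient.\<close>

lemma coord_in_Fq:
  assumes "(x::'a) \<in> Fq2 q"
  shows "fst_coord x \<in> Fq q" "snd_coord x \<in> Fq q"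
proof -
  have "(snd_coord x) ^ q = (x ^ q - x) / (\<tau> ^ q - \<tau>)"
    using assms tau_q by (simp add: snd_coord_def frob_simps Fq2_iff)
  also have "\<dots> = snd_coord x" 
    by (metis minus_diff_eq minus_divide_divide snd_coord_def)
  finally have *: "(snd_coord x) ^ q = snd_coord x" .
  have "(fst_coord x) ^ q = x ^ q - snd_coord x * \<tau> ^ q"
    by (simp add: fst_coord_def frob_simps *)
  also have "\<dots> = fst_coord x" using coord_sum_conj[of x] by (simp add: algebra_simps)
  finally show "fst_coord x \<in> Fq q" "snd_coord x \<in> Fq q" using * by (auto simp: Fq_iff)
qed

lemma coord_unique:
  assumes "x0 \<in> Fq q" "x1 \<in> Fq q"
  shows "fst_coord (x0 + x1 * \<tau>) = x0" "snd_coord (x0 + x1 * \<tau>) = x1"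
proof -
  have "snd_coord (x0 + x1 * \<tau>) = x1 * (\<tau> - \<tau> ^ q) / (\<tau> - \<tau> ^ q)"
    using assms by (simp add: snd_coord_def frob_simps Fq_iff algebra_simps)
  then show *: "snd_coord (x0 + x1 * \<tau>) = x1" using tau_q by simp
  show "fst_coord (x0 + x1 * \<tau>) = x0" by (simp add: fst_coord_def *)
qed

end

section \<open>Vectors indexed by \<open>3\<close> and \<open>5\<close>\<close>

text \<open>The library enumerates the index type \<open>3\<close> as 1, 2, 3, while the definitions
  index from 0; this identity translates between the two.\<close>

lemma of_three: "(3::3) = 0" by simp

lemma exhaust_3': "x = 0 \<or> x = 1 \<or> x = 2" for x :: 3
  using exhaust_3[of x] by (auto simp: of_three)

lemma forall_3': "(\<forall>i::3. P i) \<longleftrightarrow> P 0 \<and> P 1 \<and> P 2"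
  by (metis exhaust_3')

lemma vec3_eq_iff: "v = w \<longleftrightarrow> v $ 0 = w $ 0 \<and> v $ 1 = w $ 1 \<and> v $ 2 = w $ 2" for v w :: "'b^3"
  by (simp add: vec_eq_iff forall_3')

lemma sum_3': "sum f (UNIV::3 set) = f 0 + f 1 + f 2" for f :: "3 \<Rightarrow> 'b::comm_monoid_add"
  unfolding sum_3 of_three by (simp add: ac_simps)

lemma exhaust_5:
  fixes x :: 5
  shows "x = 0 \<or> x = 1 \<or> x = 2 \<or> x = 3 \<or> x = 4"
proof (induct x)
  case (of_int z)
  then have "z = 0 \<or> z = 1 \<or> z = 2 \<or> z = 3 \<or> z = 4" by fastforce
  then show ?case by auto
qed

lemma forall_5: "(\<forall>i::5. P i) \<longleftrightarrow> P 0 \<and> P 1 \<and> P 2 \<and> P 3 \<and> P 4"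
  by (metis exhaust_5)

lemma UNIV_5: "(UNIV::5 set) = {0, 1, 2, 3, 4}"
  using exhaust_5 by auto

lemma sum_5: "sum f (UNIV::5 set) = f 0 + f 1 + f 2 + f 3 + f 4" for f :: "5 \<Rightarrow> 'b::comm_monoid_add"
  unfolding UNIV_5 by (simp add: add.assoc)

definition vec3 :: "'b \<Rightarrow> 'b \<Rightarrow> 'b \<Rightarrow> 'b^3" where
  "vec3 a b c = (\<chi> i. if i = 0 then a else if i = 1 then b else c)"

lemma vec3_nth [simp]: "vec3 a b c $ 0 = a" "vec3 a b c $ 1 = b" "vec3 a b c $ 2 = c"
  by (simp_all add: vec3_def)

text \<open>The quadratic Veronese map. The pair \<open>(s, t)\<close> is a homogeneous parameter,
  with \<open>s = 0\<close> as the parameter at infinity.\<close>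

definition ver :: "'b::comm_ring_1 \<Rightarrow> 'b \<Rightarrow> 'b^3" where
  "ver s t = vec3 (s\<^sup>2) (s * t) (t\<^sup>2)"

lemma ver_nth [simp]: "ver s t $ 0 = s\<^sup>2" "ver s t $ 1 = s * t" "ver s t $ 2 = t\<^sup>2"
  by (simp_all add: ver_def)

lemma ver_eq_0_iff: "ver s t = 0 \<longleftrightarrow> s = 0 \<and> t = 0" for s t :: "'b::field"
  by (auto simp: vec3_eq_iff)

lemma mult_vec_3: "(A *v x) $ i = A $ i $ 0 * x $ 0 + A $ i $ 1 * x $ 1 + A $ i $ 2 * x $ 2"
  for A :: "'b::semiring_1^3^'n"
  by (simp add: matrix_vector_mult_def sum_3')

lemma det_3': "det A = A$1$1 * A$2$2 * A$0$0 + A$1$2 * A$2$0 * A$0$1 + A$1$0 * A$2$1 * A$0$2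
    - A$1$1 * A$2$0 * A$0$2 - A$1$2 * A$2$1 * A$0$0 - A$1$0 * A$2$2 * A$0$1"
  for A :: "'b::comm_ring_1^3^3"
  by (simp only: det_3 of_three)

section \<open>Quadratics over \<open>Fq2 q\<close> split over the field with \<open>q ^ 4\<close>
  elements\<close>

context fq_tower
begin

text \<open>The \<open>q ^ 4\<close> elements of the embedded field are already roots of
  \<open>X ^ (q ^ 4) - X\<close>, which has no room for further roots.\<close>

lemma in_range_to_ac:
  fixes x :: "'a alg_closure"
  assumes "x ^ (q ^ 4) = x"
  shows "x \<in> range to_ac"
proof -
  define P where "P = (monom 1 (q ^ 4) - monom 1 1 :: 'a alg_closure poly)"
  have q4: "q ^ 4 > 1" using q_gt_1 by (intro one_less_power) auto
  then have "coeff P (q ^ 4) = 1" by (simp add: P_def)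
  then have P: "P \<noteq> 0" by auto
  have "degree P \<le> q ^ 4"
    unfolding P_def using q4 by (intro degree_diff_le) (auto simp: degree_monom_eq)
  then have le: "card {x. poly P x = 0} \<le> q ^ 4"
    using card_poly_roots_bound[OF P] by linarith
  have sub: "range to_ac \<subseteq> {x. poly P x = 0}"
    using finite_field_power_card[where ?'a = 'a]
    by (auto simp: P_def poly_monom card_eq simp flip: to_ac_power)
  have "card (range (to_ac :: 'a \<Rightarrow> _)) = q ^ 4"
    using card_image[OF inj_to_ac[where ?'a = 'a]] by (simp add: card_eq)
  with le sub have "range to_ac = {x. poly P x = 0}"
    using poly_roots_finite[OF P] by (intro card_seteq) auto
  moreover have "poly P x = 0" using assms by (simp add: P_def poly_monom)
  ultimately show ?thesis by auto
qed

text \<open>Twice the Frobenius of \<open>Fq2\<close> fixes both roots, so they lie in the field of order \<open>q^4\<close>.\<close>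
lemma monic_quadratic_has_root:
  assumes "(b::'a) \<in> Fq2 q" "c \<in> Fq2 q"
  shows "\<exists>r. r\<^sup>2 + b * r + c = 0"
proof -
  define b' c' where "b' = to_ac b" and "c' = to_ac c"
  have "\<exists>x. poly [:c', b', 1:] x = 0" by (rule alg_closed_imp_poly_has_root) simp
  then obtain x where x: "x\<^sup>2 + b' * x + c' = 0"
    by (auto simp: power2_eq_square algebra_simps)
  define y where "y = - b' - x"
  have fac: "z\<^sup>2 + b' * z + c' = (z - x) * (z - y)" for z
    using x unfolding y_def by Groebner_Basis.algebra
  obtain k where k: "q = CHAR('a) ^ k" using q_power by blast
  have prime: "Factorial_Ring.prime CHAR('a alg_closure)" using prime_CHAR_finite_field[where ?'a = 'a] by simp
  have add: "(u + v) ^ q\<^sup>2 = u ^ q\<^sup>2 + v ^ q\<^sup>2" for u v :: "'a alg_closure"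
    using freshmans_dream'[OF prime, of "q\<^sup>2" "k * 2" u v] by (simp add: k power_mult)
  have q2: "q\<^sup>2 > 0" using q_gt_1 by simp
  have zero: "(0 :: 'a alg_closure) ^ q\<^sup>2 = 0" using q2 by (simp add: power_0_left)
  have fixed: "b' ^ q\<^sup>2 = b'" "c' ^ q\<^sup>2 = c'"
    using assms by (simp_all add: b'_def c'_def Fq2_def flip: to_ac_power)
  have "(x\<^sup>2 + b' * x + c') ^ q\<^sup>2 = 0" using x zero by simp
  then have "(x ^ q\<^sup>2)\<^sup>2 + b' * x ^ q\<^sup>2 + c' = 0"
    by (simp add: add power_mult_distrib fixed flip: power_mult) (simp add: mult.commute)
  then have xy: "x ^ q\<^sup>2 = x \<or> x ^ q\<^sup>2 = y" unfolding fac by simp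
  \<comment> \<open>The sum of the roots is fixed by the power \<open>q ^ 2\<close>, so if this
    power sends \<open>x\<close> to \<open>y\<close>, it sends \<open>y\<close> back to
    \<open>x\<close>.\<close>
  have "b' + x + y = 0" by (simp add: y_def)
  then have "(b' + x + y) ^ q\<^sup>2 = 0" using zero by simp
  then have "b' + x ^ q\<^sup>2 + y ^ q\<^sup>2 = 0" by (simp add: add fixed)
  then have "b' + x ^ q\<^sup>2 + y ^ q\<^sup>2 = b' + y + x" using \<open>b' + x + y = 0\<close> by (simp add: algebra_simps)
  then have "x ^ q\<^sup>2 = y \<Longrightarrow> y ^ q\<^sup>2 = x" by simp
  with xy have "(x ^ q\<^sup>2) ^ q\<^sup>2 = x" by auto
  then have "x ^ (q ^ 4) = x" by (simp flip: power_mult power_add)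
  then obtain r where "x = to_ac r" using in_range_to_ac by blast
  then have "to_ac (r\<^sup>2 + b * r + c) = 0" using x by (simp add: b'_def c'_def)
  then show ?thesis by (intro exI[of _ r]) (simp only: to_ac_eq_0_iff)
qed

text \<open>The double Frobenius sends a root \<open>r\<close> outside \<open>Fq2 q\<close> to a
  root other than \<open>r\<close>, hence to \<open>s\<close>. This dichotomy later decides between
  \<open>g_special\<close> and \<open>gss_special\<close>.\<close>

lemma quadratic_factor:
  assumes "l0 \<in> Fq2 q" "l1 \<in> Fq2 q" "l2 \<in> Fq2 q" "(l2::'a) \<noteq> 0"
  obtains r s where "[:l0, l1, l2:] = smult l2 ([:- r, 1:] * [:- s, 1:])"
    "r \<in> Fq2 q \<and> s \<in> Fq2 q \<or> r \<notin> Fq2 q \<and> s \<notin> Fq2 q \<and> r \<noteq> s"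
proof -
  define b c where "b = l1 / l2" and "c = l0 / l2"
  have bc: "b \<in> Fq2 q" "c \<in> Fq2 q" using assms by (auto simp: b_def c_def intro: Fq2_closed)
  then obtain r where r: "r\<^sup>2 + b * r + c = 0" using monic_quadratic_has_root by blast
  define s where "s = - b - r"
  have fac: "z\<^sup>2 + b * z + c = (z - r) * (z - s)" for z
    using r unfolding s_def by Groebner_Basis.algebra
  have c: "c = r * s" using r unfolding s_def by Groebner_Basis.algebra
  have "l1 = l2 * b" "l0 = l2 * c" using assms(4) by (simp_all add: b_def c_def)
  then have 1: "[:l0, l1, l2:] = smult l2 ([:- r, 1:] * [:- s, 1:])"
    by (simp add: c s_def algebra_simps)
  have 2: "r \<in> Fq2 q \<and> s \<in> Fq2 q \<or> r \<notin> Fq2 q \<and> s \<notin> Fq2 q \<and> r \<noteq> s"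
  proof (cases "r \<in> Fq2 q")
    case True
    then show ?thesis using bc by (auto simp: s_def intro: Fq2_intros)
  next
    case False
    have "((r\<^sup>2 + b * r + c) ^ q) ^ q = 0" using r by simp
    then have "((r ^ q) ^ q)\<^sup>2 + b * (r ^ q) ^ q + c = 0"
      using bc by (simp add: frob_simps Fq2_iff power2_eq_square)
    then have "(r ^ q) ^ q = s" using False unfolding fac by (simp add: Fq2_iff)
    moreover have "r \<noteq> s" using calculation False by (auto simp: Fq2_iff)
    moreover have "s \<notin> Fq2 q"
    proof
      assume "s \<in> Fq2 q"
      then have "- b - s \<in> Fq2 q" using bc by (auto intro: Fq2_intros)
      then show False using False by (simp add: s_def)
    qed
    ultimately show ?thesis using False by auto
  qed
  show thesis using that 1 2 by blast
qed

section \<open>Rational parametrisation of conics\<close>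

text \<open>Pigeonhole: squaring is at most two-to-one, so the squares \<open>S\<close> and the set
  \<open>R\<close> of values \<open>w - u * s\<close> each fill more than half of
  \<open>Fq q\<close> and must meet.\<close>

lemma weighted_two_squares:
  assumes odd: "(2::'a) \<noteq> 0" and u: "u \<in> Fq q" "(u::'a) \<noteq> 0" and w: "w \<in> Fq q"
  shows "\<exists>g h. g \<in> Fq q \<and> h \<in> Fq q \<and> h\<^sup>2 + u * g\<^sup>2 = w"
proof -
  define S where "S = (\<lambda>x::'a. x\<^sup>2) ` Fq q"
  define R where "R = (\<lambda>s. w - u * s) ` S"
  have S0: "0 \<in> S" unfolding S_def by (intro image_eqI[of _ _ 0]) auto
  have cR: "card R = card S"
    unfolding R_def by (rule card_image) (use u in \<open>auto simp: inj_on_def\<close>)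
  have SK: "S \<subseteq> Fq q" unfolding S_def by (auto intro: Fq_power)
  have RK: "R \<subseteq> Fq q" unfolding R_def using SK u w by (auto intro!: Fq_closed)
  have "card (Fq q - {0::'a}) \<le> card (\<Union>s\<in>S - {0}. {x::'a. x\<^sup>2 = s})"
    by (rule card_mono) (auto simp: S_def)
  also have "\<dots> \<le> (\<Sum>s\<in>S - {0}. card {x::'a. x\<^sup>2 = s})" by (rule card_UN_le) simp
  also have "\<dots> \<le> (\<Sum>s\<in>S - {0}. 2)"
  proof (rule sum_mono)
    fix s assume "s \<in> S - {0}"
    then obtain x where "x\<^sup>2 = s" by (auto simp: S_def)
    then have "{x. x\<^sup>2 = s} \<subseteq> {x, - x}" by (auto simp: power2_eq_iff)
    then have "card {x. x\<^sup>2 = s} \<le> card {x, - x}" by (intro card_mono) auto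
    also have "\<dots> \<le> 2" by (simp add: card_insert_if)
    finally show "card {x. x\<^sup>2 = s} \<le> 2" .
  qed
  also have "\<dots> = 2 * card S - 2" using S0 by (simp add: card_Diff_singleton)
  finally have "card (Fq q - {0::'a}) \<le> 2 * card S - 2" .
  moreover have "card (Fq q - {0::'a}) = card (Fq q :: 'a set) - 1"
    by (subst card_Diff_singleton) auto
  moreover have "card S > 0" using S0 by (auto simp: card_gt_0_iff)
  moreover have "card (Fq q :: 'a set) > 0" by (metis Fq_0 card_gt_0_iff empty_iff finite)
  ultimately have "card (Fq q :: 'a set) < card S + card R" using cR by simp
  moreover have "card S + card R \<le> card (Fq q :: 'a set)" if "S \<inter> R = {}"
    using card_Un_disjoint[of S R] that SK RK card_mono[of "Fq q :: 'a set" "S \<union> R"] by simp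
  ultimately obtain z where "z \<in> S" "z \<in> R" by (metis disjoint_iff not_le)
  then obtain g h where "g \<in> Fq q" "h \<in> Fq q" "h\<^sup>2 = w - u * g\<^sup>2"
    by (auto simp: R_def S_def)
  then show ?thesis by (intro exI[of _ g] exI[of _ h]) simp
qed

text \<open>In characteristic 2 the number \<open>q\<close> is even, so \<open>x ^ (q div 2)\<close>
  squares to \<open>x ^ q = x\<close>.\<close>

lemma char_2_sqrt:
  assumes "(2::'a) = 0" "(x::'a) \<in> Fq q"
  shows "\<exists>y. y \<in> Fq q \<and> y\<^sup>2 = x"
proof -
  have "of_nat 2 = (0::'a)" using assms(1) by simp
  then have "CHAR('a) dvd 2" by (simp only: of_nat_eq_0_iff_char_dvd)
  then have "CHAR('a) = 2"
    using primes_dvd_imp_eq[OF prime_CHAR_finite_field[where ?'a = 'a], of 2] two_is_prime_nat by auto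
  moreover obtain k where "q = CHAR('a) ^ k" using q_power by blast
  ultimately have "even q" using q_gt_1 by (cases k) auto
  then obtain m where "q = m * 2" by (metis dvd_div_mult_self)
  then have "(x ^ m)\<^sup>2 = x ^ q" by (simp flip: power_mult)
  then have "(x ^ m)\<^sup>2 = x" using assms(2) by (simp add: Fq_iff)
  then show ?thesis using assms(2) Fq_power by blast
qed

lemma conic_has_point:
  assumes K: "{a, b, c, d, e, f} \<subseteq> Fq q" and disc: "qdisc a b c d e (f::'a) \<noteq> 0"
  shows "\<exists>x y z. {x, y, z} \<subseteq> Fq q \<and> (x \<noteq> 0 \<or> y \<noteq> 0 \<or> z \<noteq> 0)
           \<and> a * x\<^sup>2 + b * y\<^sup>2 + c * z\<^sup>2 + d * x * y + e * x * z + f * y * z = 0"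
proof (cases "(2::'a) = 0")
  case True
  \<comment> \<open>The value of the form at its nucleus \<open>(f, e, d)\<close>, which in
    characteristic 2 is polar to every vector. Adding \<open>m\<close> times the nucleus to a vector
    therefore adds \<open>Qn * m ^ 2\<close> to the value of the form.\<close>
  define Qn where "Qn = a * f\<^sup>2 + b * e\<^sup>2 + c * d\<^sup>2 + d * f * e + e * f * d + f * e * d"
  have "Qn = qdisc a b c d e f + 2 * (a * f\<^sup>2 + b * e\<^sup>2 + c * d\<^sup>2 + d * e * f - 2 * a * b * c)"
    unfolding Qn_def qdisc_def by Groebner_Basis.algebra
  then have Qn: "Qn = qdisc a b c d e f" by (simp add: True)
  have Qn0: "Qn \<noteq> 0" using disc Qn by simp
  have QnK: "Qn \<in> Fq q" unfolding Qn_def using K by (intro Fq_intros) auto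
  show ?thesis
  proof (cases "f = 0")
    case f: True
    \<comment> \<open>Here the starting vector is \<open>(1, 0, 0)\<close>, whose first coordinate
      stays 1 because \<open>f = 0\<close>.\<close>
    obtain m where m: "m \<in> Fq q" "m\<^sup>2 = - a / Qn"
      using char_2_sqrt[OF True, of "- a / Qn"] K QnK by (auto intro: Fq_intros)
    then have "Qn * m\<^sup>2 = - a" using Qn0 by simp
    moreover have "a * 1\<^sup>2 + b * (m * e)\<^sup>2 + c * (m * d)\<^sup>2 + d * 1 * (m * e) + e * 1 * (m * d) + f * (m * e) * (m * d)
        = a + Qn * m\<^sup>2 + 2 * (d * e * m)"
      unfolding mult_2 by (simp add: f Qn_def power_mult_distrib algebra_simps)
    ultimately have "a * 1\<^sup>2 + b * (m * e)\<^sup>2 + c * (m * d)\<^sup>2 + d * 1 * (m * e) + e * 1 * (m * d) + f * (m * e) * (m * d) = 0"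
      by (simp add: True)
    moreover have "{1, m * e, m * d} \<subseteq> Fq q" using m K by (auto intro: Fq_intros)
    ultimately show ?thesis by (intro exI[of _ 1] exI[of _ "m * e"] exI[of _ "m * d"]) simp
  next
    case f: False
    \<comment> \<open>Here the starting vector is \<open>(0, 1, 0)\<close>; as \<open>f\<close> is
      nonzero, \<open>m * f\<close> and \<open>1 + m * e\<close> cannot both vanish.\<close>
    obtain m where m: "m \<in> Fq q" "m\<^sup>2 = - b / Qn"
      using char_2_sqrt[OF True, of "- b / Qn"] K QnK by (auto intro: Fq_intros)
    then have "Qn * m\<^sup>2 = - b" using Qn0 by simp
    moreover have "a * (m * f)\<^sup>2 + b * (1 + m * e)\<^sup>2 + c * (m * d)\<^sup>2 + d * (m * f) * (1 + m * e)
        + e * (m * f) * (m * d) + f * (1 + m * e) * (m * d)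
        = b + Qn * m\<^sup>2 + 2 * (m * (b * e + d * f))"
      unfolding Qn_def by Groebner_Basis.algebra
    ultimately have "a * (m * f)\<^sup>2 + b * (1 + m * e)\<^sup>2 + c * (m * d)\<^sup>2 + d * (m * f) * (1 + m * e)
        + e * (m * f) * (m * d) + f * (1 + m * e) * (m * d) = 0"
      by (simp add: True)
    moreover have "{m * f, 1 + m * e, m * d} \<subseteq> Fq q" using m K by (auto intro: Fq_intros)
    moreover have "m * f \<noteq> 0 \<or> 1 + m * e \<noteq> 0" using f by auto
    ultimately show ?thesis by (intro exI[of _ "m * f"] exI[of _ "1 + m * e"] exI[of _ "m * d"]) auto
  qed
next
  case odd: False
  then have "(2::'a) * 2 \<noteq> 0" by (simp only: mult_eq_0_iff) simp
  then have four: "(4::'a) \<noteq> 0" by simp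
  show ?thesis
  proof (cases "a = 0")
    case True
    then show ?thesis by (intro exI[of _ 1] exI[of _ 0]) auto
  next
    case a: False
    \<comment> \<open>The coefficients of the binary form in \<open>y, z\<close> that remains after
      completing the square in \<open>x\<close>.\<close>
    define \<alpha> \<beta> \<gamma> where "\<alpha> = 4 * a * b - d\<^sup>2" and "\<beta> = 4 * a * f - 2 * d * e"
      and "\<gamma> = 4 * a * c - e\<^sup>2"
    have square: "4 * a * (a * x\<^sup>2 + b * y\<^sup>2 + c * z\<^sup>2 + d * x * y + e * x * z + f * y * z)
        = (2 * a * x + d * y + e * z)\<^sup>2 + (\<alpha> * y\<^sup>2 + \<beta> * y * z + \<gamma> * z\<^sup>2)" for x y z
      unfolding \<alpha>_def \<beta>_def \<gamma>_def by Groebner_Basis.algebra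
    show ?thesis
    proof (cases "\<alpha> = 0")
      case True
      define x where "x = - d / (2 * a)"
      have "2 * a * x + d * 1 + e * 0 = 0" using a odd by (simp add: x_def)
      then have "4 * a * (a * x\<^sup>2 + b * 1\<^sup>2 + c * 0\<^sup>2 + d * x * 1 + e * x * 0 + f * 1 * 0) = 0"
        unfolding square using True by simp
      moreover have "{x, 1, 0} \<subseteq> Fq q" using K unfolding x_def by (auto intro!: Fq_intros)
      ultimately show ?thesis using a four
        by (intro exI[of _ x] exI[of _ 1] exI[of _ 0]) (simp only: mult_eq_0_iff, simp)
    next
      case False
      have abc: "\<alpha> \<in> Fq q" "\<beta> \<in> Fq q" "\<gamma> \<in> Fq q"
        using K unfolding \<alpha>_def \<beta>_def \<gamma>_def by (auto intro!: Fq_intros)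
      \<comment> \<open>With \<open>z = 1\<close> and \<open>g = 2 * a * x + d * y + e\<close>, the
        equation becomes \<open>g ^ 2 + \<alpha> * y ^ 2 + \<beta> * y + \<gamma> = 0\<close>.
        Multiplying by \<open>4 * \<alpha>\<close> and completing the square in \<open>y\<close>
        gives this one, with \<open>h = 2 * \<alpha> * y + \<beta>\<close>.\<close>
      obtain g h where gh: "g \<in> Fq q" "h \<in> Fq q" "h\<^sup>2 + 4 * \<alpha> * g\<^sup>2 = \<beta>\<^sup>2 - 4 * \<alpha> * \<gamma>"
        using weighted_two_squares[OF odd, of "4 * \<alpha>" "\<beta>\<^sup>2 - 4 * \<alpha> * \<gamma>"] abc False four
        by (auto intro: Fq_intros simp: mult.assoc)
      define y where "y = (h - \<beta>) / (2 * \<alpha>)"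
      define x where "x = (g - d * y - e) / (2 * a)"
      have y: "2 * \<alpha> * y + \<beta> = h" using False odd by (simp add: y_def)
      have x: "2 * a * x + d * y + e * 1 = g" using a odd by (simp add: x_def)
      have "4 * \<alpha> * (g\<^sup>2 + (\<alpha> * y\<^sup>2 + \<beta> * y + \<gamma>)) = 0"
        using gh(3) unfolding y[symmetric] by Groebner_Basis.algebra
      then have "g\<^sup>2 + (\<alpha> * y\<^sup>2 + \<beta> * y + \<gamma>) = 0" using False four by (simp only: mult_eq_0_iff) simp
      then have "4 * a * (a * x\<^sup>2 + b * y\<^sup>2 + c * 1\<^sup>2 + d * x * y + e * x * 1 + f * y * 1) = 0"
        unfolding square x by simp
      moreover have yK: "y \<in> Fq q" using abc gh unfolding y_def by (auto intro!: Fq_intros)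
      moreover have "x \<in> Fq q" using yK K gh unfolding x_def by (auto intro!: Fq_intros)
      ultimately show ?thesis using a four
        by (intro exI[of _ x] exI[of _ y] exI[of _ 1]) (simp only: mult_eq_0_iff, simp)
    qed
  qed
qed

definition conic_param :: "'a^3^3 \<Rightarrow> 'a \<Rightarrow> 'a \<Rightarrow> 'a \<Rightarrow> 'a \<Rightarrow> 'a \<Rightarrow> 'a \<Rightarrow> bool" where
  "conic_param N a b c d e f \<longleftrightarrow> mat_over (Fq q) N \<and> det N \<noteq> 0
     \<and> (\<forall>s t. qform a b c d e f (N *v ver s t) = 0)
     \<and> (\<forall>v. over (Fq q) v \<and> v \<noteq> 0 \<and> qform a b c d e f v = 0 \<longrightarrow>
          (\<exists>s t k. {s, t, k} \<subseteq> Fq q \<and> k \<noteq> 0 \<and> v = k *s (N *v ver s t)))"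

text \<open>Projection from the rational point \<open>u = (1, u1, u2)\<close>: with \<open>w = (0, s, t)\<close> and the polar
  form \<open>B\<close>, the line through \<open>u\<close> and \<open>w\<close> meets the conic again in \<open>B(u, w) w - Q(w) u\<close>.\<close>
lemma conic_param_from_point:
  assumes K: "{a, b, c, d, e, f, u1, u2} \<subseteq> Fq q"
    and u: "a + b * u1\<^sup>2 + c * u2\<^sup>2 + d * u1 + e * u2 + f * u1 * u2 = (0::'a)"
    and disc: "qdisc a b c d e f \<noteq> 0"
  shows "\<exists>N. conic_param N a b c d e f"
proof -
  define \<beta> \<gamma> where "\<beta> = d + 2 * b * u1 + f * u2" and "\<gamma> = e + f * u1 + 2 * c * u2"
  \<comment> \<open>The value of the form at \<open>(0, \<gamma>, - \<beta>)\<close>, the direction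
    of the tangent at \<open>u\<close>, where \<open>B(u, w) = \<beta> * s + \<gamma> * t\<close>
    vanishes.\<close>
  define \<delta> where "\<delta> = b * \<gamma>\<^sup>2 - f * \<beta> * \<gamma> + c * \<beta>\<^sup>2"
  \<comment> \<open>The rows hold the coefficients of \<open>s ^ 2\<close>, \<open>s * t\<close>,
    \<open>t ^ 2\<close> in the coordinates of \<open>B(u, w) w - Q(w) u\<close>.\<close>
  define N where "N = vec3 (vec3 (- b) (- f) (- c))
      (vec3 (\<beta> - u1 * b) (\<gamma> - u1 * f) (- (u1 * c))) (vec3 (- (u2 * b)) (\<beta> - u2 * f) (\<gamma> - u2 * c))"
  have a: "a = - (b * u1\<^sup>2 + c * u2\<^sup>2 + d * u1 + e * u2 + f * u1 * u2)"
    using u by Groebner_Basis.algebra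
  have \<delta>: "\<delta> = - qdisc a b c d e f"
    unfolding \<delta>_def \<beta>_def \<gamma>_def qdisc_def a by Groebner_Basis.algebra
  have detN: "det N = - \<delta>"
    unfolding det_3' N_def \<delta>_def vec3_nth by Groebner_Basis.algebra
  have "{\<beta>, \<gamma>} \<subseteq> Fq q" using K unfolding \<beta>_def \<gamma>_def by (auto intro!: Fq_intros)
  then have NK: "mat_over (Fq q) N"
    using K unfolding mat_over_def forall_3' N_def by (auto intro!: Fq_intros)
  have Nver: "N *v ver s t = (\<beta> * s + \<gamma> * t) *s vec3 0 s t
      - (b * s\<^sup>2 + c * t\<^sup>2 + f * s * t) *s vec3 1 u1 u2" for s t
    by (simp add: vec3_eq_iff mult_vec_3 N_def algebra_simps power2_eq_square)
  have on_conic: "qform a b c d e f (N *v ver s t) = 0" for s t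
    unfolding Nver qform_def a \<beta>_def \<gamma>_def by simp Groebner_Basis.algebra
  have all_points: "\<exists>s t k. {s, t, k} \<subseteq> Fq q \<and> k \<noteq> 0 \<and> v = k *s (N *v ver s t)"
    if v: "over (Fq q) v" "v \<noteq> 0" "qform a b c d e f v = 0" for v
  proof -
    have vK: "v $ 0 \<in> Fq q" "v $ 1 \<in> Fq q" "v $ 2 \<in> Fq q" using v(1) by (auto simp: Defs.over_def)
    define s t where "s = v $ 1 - v $ 0 * u1" and "t = v $ 2 - v $ 0 * u2"
    define l where "l = \<beta> * s + \<gamma> * t"
    define w where "w = b * s\<^sup>2 + c * t\<^sup>2 + f * s * t"
    have stK: "{s, t} \<subseteq> Fq q" using vK K unfolding s_def t_def by (auto intro!: Fq_intros)
    have lK: "l \<in> Fq q" unfolding l_def using stK \<open>{\<beta>, \<gamma>} \<subseteq> Fq q\<close> by (auto intro!: Fq_intros)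
    have v_eq: "v = vec3 0 s t + v $ 0 *s vec3 1 u1 u2"
      by (simp add: vec3_eq_iff s_def t_def)
    have Qv: "v $ 0 * l + w = 0"
      using v(3) unfolding qform_def a w_def l_def s_def t_def \<beta>_def \<gamma>_def by Groebner_Basis.algebra
    show ?thesis
    proof (cases "l = 0")
      case False
      have "w = - (v $ 0 * l)" using Qv by (simp add: add_eq_0_iff)
      then have "N *v ver s t = l *s v"
        unfolding Nver l_def[symmetric] w_def[symmetric]
        by (simp add: vec3_eq_iff s_def t_def algebra_simps)
      then have "v = (1 / l) *s (N *v ver s t)" using False by (simp add: vector_smult_assoc)
      moreover have "1 / l \<in> Fq q" using lK by (auto intro!: Fq_intros)
      ultimately show ?thesis using stK False
        by (intro exI[of _ s] exI[of _ t] exI[of _ "1 / l"]) auto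
    next
      case True
      \<comment> \<open>Both forms \<open>l\<close> and \<open>w\<close> vanish at
        \<open>(s, t)\<close>, so nondegeneracy forces \<open>s = t = 0\<close> and \<open>v\<close>
        is a multiple of \<open>u\<close>. That point is reached at the tangent parameter
        \<open>(\<gamma>, - \<beta>)\<close>.\<close>
      then have w0: "w = 0" using Qv by simp
      have "t\<^sup>2 * \<delta> = 0" "s\<^sup>2 * \<delta> = 0"
        using w0 True unfolding w_def l_def \<delta>_def by Groebner_Basis.algebra+
      then have st0: "s = 0" "t = 0" using \<delta> disc by auto
      have "v $ 0 \<noteq> 0" using v_eq v(2) st0 by (auto simp: vec3_eq_iff)
      have "N *v ver \<gamma> (- \<beta>) = (- \<delta>) *s vec3 1 u1 u2"
        unfolding Nver \<delta>_def by (simp add: vec3_eq_iff algebra_simps)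
      then have "v = (v $ 0 / (- \<delta>)) *s (N *v ver \<gamma> (- \<beta>))"
        using v_eq st0 \<delta> disc by (simp add: vec3_eq_iff)
      moreover have "\<delta> \<in> Fq q" unfolding \<delta>_def
        using K \<open>{\<beta>, \<gamma>} \<subseteq> Fq q\<close> by (auto intro!: Fq_intros)
      then have "v $ 0 / (- \<delta>) \<in> Fq q" using vK by (auto intro!: Fq_intros)
      ultimately show ?thesis using \<open>v $ 0 \<noteq> 0\<close> \<delta> disc \<open>{\<beta>, \<gamma>} \<subseteq> Fq q\<close>
        by (intro exI[of _ \<gamma>] exI[of _ "- \<beta>"] exI[of _ "v $ 0 / (- \<delta>)"]) (auto intro: Fq_minus)
    qed
  qed
  show ?thesis
    unfolding conic_param_def using NK detN \<delta> disc on_conic all_points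
    by (intro exI[of _ N]) auto
qed

text \<open>Lets coordinates be exchanged, so that projecting from a rational point needs only the
  case of a nonzero first coordinate. Permuting rows changes \<open>det N\<close> at most by a
  sign.\<close>

lemma conic_param_permute:
  assumes "conic_param N a' b' c' d' e' f'"
    and p: "p permutes (UNIV :: 3 set)" "\<And>i. p (p i) = i"
    and Q: "\<And>v :: 'a^3. qform a b c d e f v = qform a' b' c' d' e' f' (\<chi> i. v $ p i)"
  shows "conic_param (\<chi> i. N $ p i) a b c d e f"
proof -
  have mult: "(\<chi> i. N $ p i) *v x = (\<chi> i. (N *v x) $ p i)" for x
    by (simp add: vec_eq_iff matrix_vector_mult_def)
  have "det (\<chi> i. N $ p i) = of_int (sign p) * det N" by (rule det_permute_rows[OF p(1)])
  then have "det (\<chi> i. N $ p i) \<noteq> 0" using assms(1) by (auto simp: conic_param_def sign_def)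
  moreover have "\<exists>s t k. {s, t, k} \<subseteq> Fq q \<and> k \<noteq> 0 \<and> v = k *s ((\<chi> i. N $ p i) *v ver s t)"
    if v: "over (Fq q) v" "v \<noteq> 0" "qform a b c d e f v = 0" for v
  proof -
    have "(\<chi> i. v $ p i) \<noteq> 0"
      using v(2) p(2) by (metis vec_eq_iff vec_lambda_beta zero_index)
    moreover have "over (Fq q) (\<chi> i. v $ p i)" using v(1) by (simp add: Defs.over_def)
    ultimately obtain s t k where *: "{s, t, k} \<subseteq> Fq q" "k \<noteq> 0" "(\<chi> i. v $ p i) = k *s (N *v ver s t)"
      using assms(1) v(3) unfolding conic_param_def Q by blast
    have "v = (\<chi> i. (\<chi> i. v $ p i) $ p i)" by (simp add: p(2))
    also have "\<dots> = k *s ((\<chi> i. N $ p i) *v ver s t)" unfolding * mult by (simp add: vec_eq_iff)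
    finally show ?thesis using * by blast
  qed
  ultimately show ?thesis
    using assms(1) unfolding conic_param_def mult Q
    by (auto simp: mat_over_def p(2))
qed

lemma conic_param_exists:
  assumes K: "{a, b, c, d, e, f} \<subseteq> Fq q" and disc: "qdisc a b c d e (f::'a) \<noteq> 0"
  shows "\<exists>N. conic_param N a b c d e f"
proof -
  obtain x y z where K': "{x, y, z} \<subseteq> Fq q" and nz: "x \<noteq> 0 \<or> y \<noteq> 0 \<or> z \<noteq> 0"
    and Q: "a * x\<^sup>2 + b * y\<^sup>2 + c * z\<^sup>2 + d * x * y + e * x * z + f * y * z = 0"
    using conic_has_point[OF K disc] by blast
  from nz consider "x \<noteq> 0" | "y \<noteq> 0" | "z \<noteq> 0" by blast
  then show ?thesis
  proof cases
    case 1
    have "a + b * (y / x)\<^sup>2 + c * (z / x)\<^sup>2 + d * (y / x) + e * (z / x) + f * (y / x) * (z / x)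
        = (a * x\<^sup>2 + b * y\<^sup>2 + c * z\<^sup>2 + d * x * y + e * x * z + f * y * z) / x\<^sup>2"
      using 1 by (simp add: field_simps power2_eq_square)
    then show ?thesis
      using K K' Q disc by (intro conic_param_from_point[of a b c d e f "y / x" "z / x"]) (auto intro: Fq_closed)
  next
    case 2
    have "b + a * (x / y)\<^sup>2 + c * (z / y)\<^sup>2 + d * (x / y) + f * (z / y) + e * (x / y) * (z / y)
        = (a * x\<^sup>2 + b * y\<^sup>2 + c * z\<^sup>2 + d * x * y + e * x * z + f * y * z) / y\<^sup>2"
      using 2 by (simp add: field_simps power2_eq_square)
    moreover have "qdisc b a c d f e = qdisc a b c d e f" by (simp add: qdisc_def algebra_simps)
    ultimately have "\<exists>N. conic_param N b a c d f e"
      using K K' Q disc by (intro conic_param_from_point[of b a c d f e "x / y" "z / y"]) (auto intro: Fq_closed)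
    then obtain N where "conic_param N b a c d f e" ..
    then have "conic_param (\<chi> i. N $ Transposition.transpose 0 1 i) a b c d e f"
      by (rule conic_param_permute) (auto simp: permutes_swap_id qform_def algebra_simps)
    then show ?thesis by blast
  next
    case 3
    have "c + b * (y / z)\<^sup>2 + a * (x / z)\<^sup>2 + f * (y / z) + e * (x / z) + d * (y / z) * (x / z)
        = (a * x\<^sup>2 + b * y\<^sup>2 + c * z\<^sup>2 + d * x * y + e * x * z + f * y * z) / z\<^sup>2"
      using 3 by (simp add: field_simps power2_eq_square)
    moreover have "qdisc c b a f e d = qdisc a b c d e f" by (simp add: qdisc_def algebra_simps)
    ultimately have "\<exists>N. conic_param N c b a f e d"
      using K K' Q disc by (intro conic_param_from_point[of c b a f e d "y / z" "x / z"]) (auto intro: Fq_closed)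
    then obtain N where "conic_param N c b a f e d" ..
    then have "conic_param (\<chi> i. N $ Transposition.transpose 0 2 i) a b c d e f"
      by (rule conic_param_permute) (auto simp: permutes_swap_id qform_def algebra_simps)
    then show ?thesis by blast
  qed
qed

end

section \<open>The normal rational curve of a parametrised conic\<close>

lemma vec5_nth [simp]: "vec5 a b c d e $ 0 = a" "vec5 a b c d e $ 1 = b" "vec5 a b c d e $ 2 = c"
  "vec5 a b c d e $ 3 = d" "vec5 a b c d e $ 4 = e"
  by (simp_all add: vec5_def)

lemma vec5_eq_iff: "v = w \<longleftrightarrow> v $ 0 = w $ 0 \<and> v $ 1 = w $ 1 \<and> v $ 2 = w $ 2 \<and> v $ 3 = w $ 3 \<and> v $ 4 = w $ 4"
  for v w :: "'b^5"
  by (simp add: vec_eq_iff forall_5)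

lemma mult_vec_eq_0_iff:
  fixes A :: "'b::field^'n^'n"
  assumes "det A \<noteq> 0"
  shows "A *v x = 0 \<longleftrightarrow> x = 0"
  using assms by (metis invertible_det_nz invertible_def matrix_left_invertible_ker matrix_vector_mult_0_right)

lemma mult_vec_cancel:
  fixes A :: "'b::field^'n^'n"
  assumes "det A \<noteq> 0" "A *v x = A *v y"
  shows "x = y"
  using mult_vec_eq_0_iff[OF assms(1), of "x - y"] assms(2) by (simp add: matrix_vector_mult_diff_distrib)

lemma det_nz_iff_rows:
  fixes A :: "'b::field^'n^'n"
  shows "det A \<noteq> 0 \<longleftrightarrow> (\<forall>y. (\<forall>k. (\<Sum>i\<in>UNIV. y $ i * A $ i $ k) = 0) \<longrightarrow> y = 0)"
proof -
  have "det A \<noteq> 0 \<longleftrightarrow> (\<forall>y. transpose A *v y = 0 \<longrightarrow> y = 0)"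
    using invertible_det_nz[of "transpose A"]
    by (metis det_transpose invertible_left_inverse matrix_left_invertible_ker)
  moreover have "transpose A *v y = 0 \<longleftrightarrow> (\<forall>k. (\<Sum>i\<in>UNIV. y $ i * A $ i $ k) = 0)" for y
    by (simp add: vec_eq_iff matrix_vector_mult_def transpose_def mult.commute)
  ultimately show ?thesis by simp
qed

lemma pt_eqD: "pt v = pt w \<Longrightarrow> \<exists>k. v = k *s w"
proof -
  assume "pt v = pt w"
  moreover have "v \<in> pt v" unfolding pt_def by (intro image_eqI[of _ _ 1]) auto
  ultimately show ?thesis by (auto simp: pt_def)
qed

lemma pt_smult: "k \<noteq> 0 \<Longrightarrow> pt (k *s v) = pt v"
proof (intro equalityI subsetI)
  fix x assume k: "k \<noteq> 0" and "x \<in> pt v"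
  then obtain c where "x = c *s v" by (auto simp: pt_def)
  then have "x = (c / k) *s (k *s v)" using k by (simp add: vector_smult_assoc)
  then show "x \<in> pt (k *s v)" unfolding pt_def by (metis rangeI)
qed (auto simp: pt_def vector_smult_assoc)

lemma PG_UNIV_I: "v \<noteq> 0 \<Longrightarrow> pt v \<in> PG UNIV"
  by (auto simp: PG_def Defs.over_def)

text \<open>The coefficient vector of the product of the binary quadratic forms with coefficients
  \<open>x\<close> and \<open>y\<close>.\<close>

definition conv :: "'b::semiring_1^3 \<Rightarrow> 'b^3 \<Rightarrow> 'b^5" where
  "conv x y = vec5 (x$0 * y$0) (x$0 * y$1 + x$1 * y$0) (x$0 * y$2 + x$1 * y$1 + x$2 * y$0)
     (x$1 * y$2 + x$2 * y$1) (x$2 * y$2)"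

text \<open>Homogeneous version of \<open>nu\<close>; the parameter \<open>(0, 1)\<close> gives
  \<open>nu_inf\<close>, so infinity needs no separate evaluation.\<close>

definition nuh :: "'b::comm_ring_1 \<Rightarrow> 'b \<Rightarrow> 'b^5" where
  "nuh s t = vec5 (s ^ 4) (s ^ 3 * t) (s ^ 2 * t ^ 2) (s * t ^ 3) (t ^ 4)"

definition quad :: "'b::zero^3 \<Rightarrow> 'b poly" where
  "quad x = [:x$0, x$1, x$2:]"

lemma conv_eval: "(\<Sum>k\<in>UNIV. conv x y $ k * nuh s t $ k)
    = (x$0 * s\<^sup>2 + x$1 * (s * t) + x$2 * t\<^sup>2) * (y$0 * s\<^sup>2 + y$1 * (s * t) + y$2 * t\<^sup>2)"
  for s :: "'b::comm_ring_1"
  by (simp add: sum_5 conv_def nuh_def algebra_simps power2_eq_square power3_eq_cube power4_eq_xxxx)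

lemma conv_poly: "[:conv x y $ 0, conv x y $ 1, conv x y $ 2, conv x y $ 3, conv x y $ 4:] = quad x * quad y"
  for x :: "'b::comm_ring_1^3"
  by (simp add: conv_def quad_def algebra_simps)

lemma nu_eq_nuh: "nu t = nuh 1 t"
  by (simp add: nu_def nuh_def vec5_eq_iff)

lemma nu_inf_eq_nuh: "nu_inf = nuh 0 1"
  by (simp add: nu_inf_def nuh_def vec5_eq_iff)

lemma order_linear_poly: "Polynomial.order t [:- r, 1:] = (if t = r then 1 else 0)" for r :: "'b::field"
  by (auto simp: order_0I order_power_n_n[of _ 1, simplified])

text \<open>The quartic has full degree, so the parameter at infinity contributes
  \<open>4 - 4 = 0\<close>. Among the roots only \<open>r\<close> and \<open>s\<close> count, and a
  repeated root \<open>r = s\<close> has order 2 because it differs from \<open>r'\<close> and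
  \<open>s'\<close>.\<close>

lemma int_mult_eq_2:
  assumes h: "hpoly M = smult c (([:- r, 1:] * [:- s, 1:]) * ([:- r', 1:] * [:- s', 1:]))"
    and c: "c \<noteq> 0" and rs: "{r, s} \<subseteq> Fq2 q" "{r, s} \<inter> {r', s'} = {}"
    and L: "\<And>t. t \<in> Fq2 q \<Longrightarrow> poly (hpoly M) t = 0 \<Longrightarrow> pt (M *v nu t) \<in> L \<longleftrightarrow> t \<in> {r, s}"
  shows "int_mult q M L = 2"
proof -
  have "degree (hpoly M) = 4"
    unfolding h using c by (simp add: degree_mult_eq)
  moreover have roots: "poly (hpoly M) r = 0" "poly (hpoly M) s = 0"
    unfolding h poly_smult poly_mult by simp_all
  have "{t. t \<in> Fq2 q \<and> poly (hpoly M) t = 0 \<and> pt (M *v nu t) \<in> L} = {r, s}"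
    using L rs(1) roots by auto
  moreover have "Polynomial.order t (hpoly M) = (if t = r then 1 else 0) + (if t = s then 1 else 0)"
    if "t \<in> {r, s}" for t
  proof -
    have "t \<noteq> r'" "t \<noteq> s'" using that rs(2) by auto
    then show ?thesis
      unfolding h using c by (simp add: order_smult order_mult order_linear_poly del: mult_pCons_left mult_pCons_right)
  qed
  then have "(\<Sum>t\<in>{r, s}. Polynomial.order t (hpoly M)) = 2" by (cases "r = s") auto
  ultimately show ?thesis by (simp add: int_mult_def)
qed

section \<open>Conjugation and the matrix of the quartic curve\<close>

context fq_tower
begin

definition cj :: "'a^'n \<Rightarrow> 'a^'n" where
  "cj x = (\<chi> i. x $ i ^ q)"

lemma cj_nth [simp]: "cj x $ i = x $ i ^ q"
  by (simp add: cj_def)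

definition cjm :: "'a^'n^'m \<Rightarrow> 'a^'n^'m" where
  "cjm A = (\<chi> i. cj (A $ i))"

lemma cjm_nth [simp]: "cjm A $ i = cj (A $ i)"
  by (simp add: cjm_def)

lemma det_cjm: "det (cjm A) = det A ^ q" for A :: "'a^3^3"
  by (simp add: det_3' frob_simps)

text \<open>The first four rows split the coefficients of \<open>a l'\<close> and
  \<open>b l'\<close> along \<open>1, \<tau>\<close>; the last row is the norm form
  \<open>l l'\<close>.\<close>

definition nrc_mat :: "'a^3^3 \<Rightarrow> 'a^5^5" where
  "nrc_mat A = vec5
     (\<chi> k. fst_coord (conv (A $ 0) (cj (A $ 2)) $ k)) (\<chi> k. snd_coord (conv (A $ 0) (cj (A $ 2)) $ k))
     (\<chi> k. fst_coord (conv (A $ 1) (cj (A $ 2)) $ k)) (\<chi> k. snd_coord (conv (A $ 1) (cj (A $ 2)) $ k))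
     (conv (A $ 2) (cj (A $ 2)))"

end

text \<open>The homogeneous quadratic forms given by the last row \<open>l\<close> of \<open>A\<close> and its conjugate have no
  common zero: this is how \<open>T \<notin> C\<close> enters.\<close>

locale param_conic = fq_tower q \<tau> for q and \<tau> :: "'a::{field,finite}" +
  fixes A :: "'a^3^3"
  assumes A_over: "mat_over (Fq2 q) A" and det_A: "det A \<noteq> 0"
    and no_common_zero: "\<And>s t. (A *v ver s t) $ 2 = 0 \<Longrightarrow> (cjm A *v ver s t) $ 2 = 0 \<Longrightarrow> s = 0 \<and> t = 0"
begin

abbreviation "P \<equiv> nrc_mat A"

lemma A_nth: "A $ i $ j \<in> Fq2 q"
  using A_over by (simp add: mat_over_def)

lemma conv_in_Fq2: "conv (A $ i) (cj (A $ j)) $ k \<in> Fq2 q"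
  using exhaust_5[of k] A_nth by (auto simp: conv_def intro!: Fq2_intros)

lemma conv_conj: "(conv (A $ i) (cj (A $ j)) $ k) ^ q = conv (cj (A $ i)) (A $ j) $ k"
  using exhaust_5[of k] A_nth by (auto simp: conv_def frob_simps Fq2_iff)

lemma P_over: "mat_over (Fq q) P"
proof -
  have "(conv (A $ 2) (cj (A $ 2)) $ k) ^ q = conv (A $ 2) (cj (A $ 2)) $ k" for k
    unfolding conv_conj using exhaust_5[of k] by (auto simp: conv_def algebra_simps)
  then have "P $ i $ k \<in> Fq q" for i k
    using exhaust_5[of i] by (auto simp: nrc_mat_def coord_in_Fq conv_in_Fq2) (simp add: Fq_iff)
  then show ?thesis by (simp add: mat_over_def)
qed

text \<open>The identities hold coefficientwise, so \<open>s\<close> and \<open>t\<close> range over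
  the whole field, where the value of \<open>l'\<close> need not be the conjugate of the value of
  \<open>l\<close>. The left sides involving \<open>\<tau> ^ q\<close> are those of the equations of
  \<open>g\<close>.\<close>

lemma P_eval:
  defines "a \<equiv> \<lambda>s t. (A *v ver s t) $ 0" and "b \<equiv> \<lambda>s t. (A *v ver s t) $ 1"
    and "l \<equiv> \<lambda>s t. (A *v ver s t) $ 2"
    and "a' \<equiv> \<lambda>s t. (cjm A *v ver s t) $ 0" and "b' \<equiv> \<lambda>s t. (cjm A *v ver s t) $ 1"
    and "l' \<equiv> \<lambda>s t. (cjm A *v ver s t) $ 2"
  shows "(P *v nuh s t) $ 0 + (P *v nuh s t) $ 1 * \<tau> = a s t * l' s t"
    "(P *v nuh s t) $ 2 + (P *v nuh s t) $ 3 * \<tau> = b s t * l' s t"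
    "(P *v nuh s t) $ 0 + (P *v nuh s t) $ 1 * \<tau> ^ q = a' s t * l s t"
    "(P *v nuh s t) $ 2 + (P *v nuh s t) $ 3 * \<tau> ^ q = b' s t * l s t"
    "(P *v nuh s t) $ 4 = l s t * l' s t"
proof -
  have ev: "(\<Sum>k\<in>UNIV. conv (A $ i) (cj (A $ 2)) $ k * nuh s t $ k) = (A *v ver s t) $ i * l' s t"
    "(\<Sum>k\<in>UNIV. conv (cj (A $ i)) (A $ 2) $ k * nuh s t $ k) = (cjm A *v ver s t) $ i * l s t" for i
    unfolding conv_eval l_def l'_def mult_vec_3 by simp_all
  have l_l': "l s t * l' s t = (\<Sum>k\<in>UNIV. conv (A $ 2) (cj (A $ 2)) $ k * nuh s t $ k)"
    unfolding ev l_def by simp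
  have combine: "(\<Sum>k\<in>UNIV. f k * w $ k) + (\<Sum>k\<in>UNIV. g k * w $ k) * u
      = (\<Sum>k\<in>UNIV. (f k + g k * u) * w $ k)" for f g :: "5 \<Rightarrow> 'a" and w u
    by (simp add: sum.distrib sum_distrib_left sum_distrib_right algebra_simps)
  show "(P *v nuh s t) $ 0 + (P *v nuh s t) $ 1 * \<tau> = a s t * l' s t"
    "(P *v nuh s t) $ 2 + (P *v nuh s t) $ 3 * \<tau> = b s t * l' s t"
    "(P *v nuh s t) $ 0 + (P *v nuh s t) $ 1 * \<tau> ^ q = a' s t * l s t"
    "(P *v nuh s t) $ 2 + (P *v nuh s t) $ 3 * \<tau> ^ q = b' s t * l s t"
    "(P *v nuh s t) $ 4 = l s t * l' s t"
    unfolding a_def b_def a'_def b'_def ev[symmetric] l_l'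
    by (simp_all add: nrc_mat_def matrix_vector_mult_def combine coord_sum coord_sum_conj conv_conj)
qed

text \<open>Otherwise \<open>l\<close> and \<open>l'\<close> would both vanish at
  \<open>(0, 1)\<close>. Hence \<open>l\<close> has degree 2 and the curve does not meet the
  hyperplane at the parameter infinity.\<close>

lemma lead_nz: "A $ 2 $ 2 \<noteq> 0"
  using no_common_zero[of 0 1] by (auto simp: mult_vec_3)

lemma quad_eval: "poly (quad (B $ i)) t = (B *v ver 1 t) $ i" for B :: "'a^3^3"
  by (simp add: quad_def mult_vec_3 algebra_simps power2_eq_square)

lemma quad_independent:
  fixes B :: "'a^3^3"
  assumes "det B \<noteq> 0"
    and "smult x (quad (B $ 0)) + smult y (quad (B $ 1)) + smult z (quad (B $ 2)) = 0"
  shows "x = 0 \<and> y = 0 \<and> z = 0"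
proof -
  have "\<forall>k. (\<Sum>i\<in>UNIV. vec3 x y z $ i * B $ i $ k) = 0"
    using assms(2) by (simp add: sum_3' forall_3' quad_def)
  then have "vec3 x y z = 0" using assms(1) det_nz_iff_rows[of B] by blast
  then show ?thesis by (simp add: vec3_eq_iff)
qed

lemma hpoly_P: "hpoly P = quad (A $ 2) * quad (cj (A $ 2))"
  unfolding conv_poly[symmetric] by (simp add: hpoly_def nrc_mat_def)

text \<open>Conjugating the coefficients of a factorisation conjugates its roots.\<close>

lemma l_factor:
  obtains r s where "quad (A $ 2) = smult (A $ 2 $ 2) ([:- r, 1:] * [:- s, 1:])"
    "quad (cj (A $ 2)) = smult (A $ 2 $ 2 ^ q) ([:- (r ^ q), 1:] * [:- (s ^ q), 1:])"
    "r \<in> Fq2 q \<and> s \<in> Fq2 q \<or> r \<notin> Fq2 q \<and> s \<notin> Fq2 q \<and> r \<noteq> s"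
proof -
  obtain r s where rs: "quad (A $ 2) = smult (A $ 2 $ 2) ([:- r, 1:] * [:- s, 1:])"
    "r \<in> Fq2 q \<and> s \<in> Fq2 q \<or> r \<notin> Fq2 q \<and> s \<notin> Fq2 q \<and> r \<noteq> s"
    unfolding quad_def using quadratic_factor[OF A_nth A_nth A_nth lead_nz] by blast
  then have c: "A $ 2 $ 0 = A $ 2 $ 2 * (r * s)" "A $ 2 $ 1 = - (A $ 2 $ 2 * (r + s))"
    by (auto simp: quad_def algebra_simps)
  have "quad (cj (A $ 2)) = smult (A $ 2 $ 2 ^ q) ([:- (r ^ q), 1:] * [:- (s ^ q), 1:])"
    unfolding quad_def cj_nth c by (simp add: frob_simps algebra_simps)
  with rs that show thesis by blast
qed

text \<open>A vanishing combination of the rows reads \<open>l' * W + l * V = 0\<close> with \<open>W\<close> in the span of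
  \<open>a, b, l\<close> and \<open>V\<close> in that of \<open>a', b'\<close>; as \<open>l\<close> and \<open>l'\<close> are coprime, \<open>W\<close> is a multiple of \<open>l\<close>.\<close>
lemma det_P: "det P \<noteq> 0"
  unfolding det_nz_iff_rows
proof (intro allI impI)
  fix y :: "'a^5"
  assume "\<forall>k. (\<Sum>i\<in>UNIV. y $ i * P $ i $ k) = 0"
  then have y: "y $ 0 * P $ 0 $ k + y $ 1 * P $ 1 $ k + y $ 2 * P $ 2 $ k + y $ 3 * P $ 3 $ k + y $ 4 * P $ 4 $ k = 0" for k
    unfolding sum_5 by blast
  define D where "D = \<tau> - \<tau> ^ q"
  have D: "D \<noteq> 0" using tau_q by (simp add: D_def)
  \<comment> \<open>These rewrite the combination of \<open>fst_coord x\<close> and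
    \<open>snd_coord x\<close> as one of \<open>x\<close> and \<open>x ^ q\<close>:
    \<open>\<alpha>\<close> and \<open>\<beta>\<close> multiply \<open>x\<close>,
    \<open>\<gamma>\<close> and \<open>\<delta>\<close> multiply \<open>x ^ q\<close>.\<close>
  define \<alpha> \<gamma> \<beta> \<delta> where "\<alpha> = (y $ 1 - \<tau> ^ q * y $ 0) / D" and "\<gamma> = (\<tau> * y $ 0 - y $ 1) / D"
    and "\<beta> = (y $ 3 - \<tau> ^ q * y $ 2) / D" and "\<delta> = (\<tau> * y $ 2 - y $ 3) / D"
  have coord: "u * fst_coord x + v * snd_coord x = (v - \<tau> ^ q * u) / D * x + (\<tau> * u - v) / D * x ^ q" for u v x
  proof -
    have "snd_coord x = (x - x ^ q) / D" by (simp add: snd_coord_def D_def)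
    moreover from this have "fst_coord x = (x * D - (x - x ^ q) * \<tau>) / D"
      unfolding fst_coord_def using D by (simp add: diff_divide_distrib left_diff_distrib)
    ultimately have "u * fst_coord x + v * snd_coord x
        = (u * (x * D - (x - x ^ q) * \<tau>) + v * (x - x ^ q)) / D" by (simp add: add_divide_distrib)
    also have "u * (x * D - (x - x ^ q) * \<tau>) + v * (x - x ^ q) = (v - \<tau> ^ q * u) * x + (\<tau> * u - v) * x ^ q"
      unfolding D_def by Groebner_Basis.algebra
    finally show ?thesis by (simp add: add_divide_distrib)
  qed
  have lin: "\<alpha> * conv (A $ 0) (cj (A $ 2)) $ k + \<gamma> * conv (cj (A $ 0)) (A $ 2) $ k
      + \<beta> * conv (A $ 1) (cj (A $ 2)) $ k + \<delta> * conv (cj (A $ 1)) (A $ 2) $ k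
      + y $ 4 * conv (A $ 2) (cj (A $ 2)) $ k = 0" for k
    using y[of k] unfolding nrc_mat_def vec5_nth vec_lambda_beta
    using coord[of "y $ 0" "conv (A $ 0) (cj (A $ 2)) $ k" "y $ 1"]
      coord[of "y $ 2" "conv (A $ 1) (cj (A $ 2)) $ k" "y $ 3"]
    unfolding \<alpha>_def[symmetric] \<beta>_def[symmetric] \<gamma>_def[symmetric] \<delta>_def[symmetric] conv_conj
    by Groebner_Basis.algebra
  define l l' where "l = quad (A $ 2)" and "l' = quad (cj (A $ 2))"
  define W where "W = smult \<alpha> (quad (A $ 0)) + smult \<beta> (quad (A $ 1)) + smult (y $ 4) l"
  define V where "V = smult \<gamma> (quad (cj (A $ 0))) + smult \<delta> (quad (cj (A $ 1)))"
  have "smult \<alpha> (quad (A $ 0) * l') + smult \<gamma> (quad (cj (A $ 0)) * l) + smult \<beta> (quad (A $ 1) * l')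
      + smult \<delta> (quad (cj (A $ 1)) * l) + smult (y $ 4) (l * l') = 0"
    unfolding l_def l'_def conv_poly[symmetric] using lin by simp
  then have WV: "W * l' + l * V = 0"
    unfolding W_def V_def by (simp add: algebra_simps)
  obtain r s where l: "l = smult (A $ 2 $ 2) ([:- r, 1:] * [:- s, 1:])"
    using l_factor unfolding l_def by metis
  have l'_nz: "poly l' t \<noteq> 0" if "poly l t = 0" for t
    using no_common_zero[of 1 t] that quad_eval[of A 2 t] quad_eval[of "cjm A" 2 t]
    unfolding l_def l'_def by auto
  have l_rs: "poly l r = 0" "poly l s = 0" unfolding l poly_smult poly_mult by simp_all
  \<comment> \<open>At a root of \<open>l\<close> the polynomial \<open>l'\<close> is nonzero, so
    \<open>W\<close> vanishes. The factor of \<open>r\<close> is cancelled before \<open>s\<close>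
    is treated, which also covers a double root.\<close>
  have "poly (W * l' + l * V) r = 0" using WV by simp
  then have "poly W r = 0" using l'_nz[OF l_rs(1)] l_rs(1) by simp
  then obtain W1 where W1: "W = [:- r, 1:] * W1" using poly_eq_0_iff_dvd by blast
  have "[:- r, 1:] * (W1 * l' + smult (A $ 2 $ 2) ([:- s, 1:] * V)) = 0"
    using WV unfolding W1 l by (simp only: algebra_simps mult_smult_left mult_smult_right)
  then have "W1 * l' + smult (A $ 2 $ 2) ([:- s, 1:] * V) = 0" by (simp only: mult_eq_0_iff) simp
  then have "poly (W1 * l' + smult (A $ 2 $ 2) ([:- s, 1:] * V)) s = 0" by simp
  then have "poly W1 s * poly l' s = 0" unfolding poly_add poly_smult poly_mult by simp
  then have "poly W1 s = 0" using l'_nz[OF l_rs(2)] by simp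
  then obtain W2 where "W1 = [:- s, 1:] * W2" using poly_eq_0_iff_dvd by blast
  with W1 have W2: "W = ([:- r, 1:] * [:- s, 1:]) * W2" by (simp only: mult.assoc)
  \<comment> \<open>Since \<open>W\<close> has degree at most 2, its cofactor \<open>W2\<close> is
    constant.\<close>
  have "degree W \<le> 2"
    unfolding W_def l_def quad_def by (intro degree_add_le degree_smult_le[THEN order_trans]) auto
  moreover have "degree W = 2 + degree W2" if "W2 \<noteq> 0"
    unfolding W2 using that by (subst degree_mult_eq) auto
  ultimately have "degree W2 = 0" by fastforce
  then obtain k where "W2 = [:k:]" by (metis degree_eq_zeroE)
  then have W: "W = smult (k / A $ 2 $ 2) l" unfolding W2 l using lead_nz by simp
  then have "smult \<alpha> (quad (A $ 0)) + smult \<beta> (quad (A $ 1)) + smult (y $ 4 - k / A $ 2 $ 2) (quad (A $ 2)) = 0"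
    unfolding W_def l_def by (simp add: smult_diff_left add_diff_eq)
  from quad_independent[OF det_A this] have ab: "\<alpha> = 0" "\<beta> = 0" and k: "k / A $ 2 $ 2 = y $ 4" by auto
  \<comment> \<open>Now \<open>W\<close> is \<open>y $ 4\<close> times \<open>l\<close>; cancelling
    \<open>l\<close> leaves a relation between the rows of the conjugate matrix, which are
    independent too.\<close>
  have "l * (V + smult (y $ 4) l') = 0"
    using WV unfolding W k by (simp add: algebra_simps)
  moreover have "l \<noteq> 0" unfolding l using lead_nz by simp
  ultimately have "V + smult (y $ 4) l' = 0" by simp
  then have "smult \<gamma> (quad (cjm A $ 0)) + smult \<delta> (quad (cjm A $ 1)) + smult (y $ 4) (quad (cjm A $ 2)) = 0"
    by (simp add: V_def l'_def)
  moreover have "det (cjm A) \<noteq> 0" using det_A by (simp add: det_cjm)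
  ultimately have cd: "\<gamma> = 0" "\<delta> = 0" "y $ 4 = 0" using quad_independent by blast+
  have solve: "u = 0 \<and> v = 0" if "(v - \<tau> ^ q * u) / D = 0" "(\<tau> * u - v) / D = 0" for u v
  proof -
    have "v = \<tau> ^ q * u" "\<tau> * u = v" using that D by auto
    then have "D * u = 0" by (simp add: D_def algebra_simps)
    then show ?thesis using D that by auto
  qed
  show "y = 0"
    using solve[of "y $ 1" "y $ 0"] solve[of "y $ 3" "y $ 2"] ab cd
    unfolding \<alpha>_def \<beta>_def \<gamma>_def \<delta>_def by (simp add: vec5_eq_iff)
qed

end

lemma mult_vec_smult: "A *v (k *s x) = k *s (A *v x)" for A :: "'b::comm_semiring_1^'n^'m"
  by (simp add: vec_eq_iff matrix_vector_mult_def sum_distrib_left mult.left_commute)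

text \<open>The equations are homogeneous, so they can be tested on any representative of the
  point.\<close>

lemma pt_in_transv_iff:
  "pt w \<in> transv K u \<longleftrightarrow> pt w \<in> PG K \<and> w $ 4 = 0 \<and> w $ 0 + w $ 1 * u = 0 \<and> w $ 2 + w $ 3 * u = 0"
proof
  assume "pt w \<in> transv K u"
  then obtain v where v: "pt w \<in> PG K" "pt w = pt v" "v $ 4 = 0" "v $ 0 + v $ 1 * u = 0" "v $ 2 + v $ 3 * u = 0"
    by (auto simp: transv_def)
  then obtain k where k: "w = k *s v" using pt_eqD by blast
  have "w $ 0 + w $ 1 * u = k * (v $ 0 + v $ 1 * u)" "w $ 2 + w $ 3 * u = k * (v $ 2 + v $ 3 * u)"
    by (simp_all add: k algebra_simps)
  with v show "pt w \<in> PG K \<and> w $ 4 = 0 \<and> w $ 0 + w $ 1 * u = 0 \<and> w $ 2 + w $ 3 * u = 0"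
    by (simp add: k)
qed (auto simp: transv_def)

context fq_tower
begin

lemma Fq_sum: "(\<And>i. i \<in> I \<Longrightarrow> f i \<in> Fq q) \<Longrightarrow> sum f I \<in> (Fq q :: 'a set)"
  by (induction I rule: infinite_finite_induct) (auto intro: Fq_closed)

lemma Fq2_sum: "(\<And>i. i \<in> I \<Longrightarrow> f i \<in> Fq2 q) \<Longrightarrow> sum f I \<in> (Fq2 q :: 'a set)"
  by (induction I rule: infinite_finite_induct) (auto intro: Fq2_closed)

lemma frob_sum: "(sum f I) ^ q = (\<Sum>i\<in>I. f i ^ q :: 'a)"
  by (induction I rule: infinite_finite_induct) (auto simp: frob_add)

lemma nuh_over: "{s, t} \<subseteq> Fq q \<Longrightarrow> nuh s t $ k \<in> (Fq q :: 'a set)"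
  using exhaust_5[of k] by (auto simp: nuh_def intro!: Fq_intros)

text \<open>A pair with \<open>s = 0\<close> gives the point at infinity, any other pair the
  parameter \<open>t / s\<close>; the scalars involved are fourth powers.\<close>

lemma nrc_pts_homogeneous:
  "nrc_pts M (Fq q) = {pt (M *v nuh s t) | s t :: 'a. {s, t} \<subseteq> Fq q \<and> (s \<noteq> 0 \<or> t \<noteq> 0)}"
proof (intro equalityI subsetI)
  fix R assume "R \<in> nrc_pts M (Fq q)"
  then consider t where "R = pt (M *v nuh 1 t)" "t \<in> Fq q" | "R = pt (M *v nuh 0 1)"
    by (auto simp: nrc_pts_def nu_eq_nuh nu_inf_eq_nuh)
  then show "R \<in> {pt (M *v nuh s t) | s t. {s, t} \<subseteq> Fq q \<and> (s \<noteq> 0 \<or> t \<noteq> 0)}"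
  proof cases
    case 1
    then show ?thesis by (intro CollectI exI[of _ 1] exI[of _ t]) simp
  next
    case 2
    then show ?thesis by (intro CollectI exI[of _ 0] exI[of _ 1]) simp
  qed
next
  fix R assume "R \<in> {pt (M *v nuh s t) | s t. {s, t} \<subseteq> Fq q \<and> (s \<noteq> 0 \<or> t \<noteq> 0)}"
  then obtain s t where R: "R = pt (M *v nuh s t)" "s \<in> Fq q" "t \<in> Fq q" "s \<noteq> 0 \<or> t \<noteq> 0" by auto
  show "R \<in> nrc_pts M (Fq q)"
  proof (cases "s = 0")
    case True
    then have "nuh s t = t ^ 4 *s nu_inf" by (simp add: vec5_eq_iff nuh_def nu_inf_def)
    then have "R = pt (M *v nu_inf)" using R True by (simp add: mult_vec_smult pt_smult)
    then show ?thesis by (simp add: nrc_pts_def)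
  next
    case False
    then have "nuh s t = s ^ 4 *s nu (t / s)"
      by (simp add: vec5_eq_iff nuh_def nu_def field_simps power2_eq_square power3_eq_cube power4_eq_xxxx)
    then have "R = pt (M *v nu (t / s))" using R False by (simp add: mult_vec_smult pt_smult)
    then show ?thesis using R by (auto simp: nrc_pts_def Fq_closed)
  qed
qed

end

section \<open>The curve compared with the transversals and with the image of the conic\<close>

context param_conic
begin

lemma P_nu_nz: "P *v nu t \<noteq> 0"
  using mult_vec_eq_0_iff[OF det_P] by (simp add: nu_def vec5_eq_iff)

text \<open>\<open>P\<close> has entries in \<open>Fq q\<close>, so it commutes with double
  conjugation. A representative over \<open>Fq2 q\<close> thus comes from a multiple
  \<open>k *s nu t\<close> that is itself fixed, and its first two coordinates \<open>k\<close> and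
  \<open>k * t\<close> put \<open>t\<close> in \<open>Fq2 q\<close>.\<close>

lemma P_nu_in_PG_iff: "pt (P *v nu t) \<in> PG (Fq2 q) \<longleftrightarrow> t \<in> Fq2 q"
proof
  assume "t \<in> Fq2 q"
  then have "nu t $ k \<in> Fq2 q" for k
    using exhaust_5[of k] by (auto simp: nu_def intro!: Fq2_intros)
  then have "over (Fq2 q) (P *v nu t)"
    using P_over by (auto simp: Defs.over_def matrix_vector_mult_def mat_over_def
        intro!: Fq2_sum Fq2_closed intro: Fq_Fq2)
  then show "pt (P *v nu t) \<in> PG (Fq2 q)" using P_nu_nz by (auto simp: PG_def)
next
  assume "pt (P *v nu t) \<in> PG (Fq2 q)"
  then obtain v where v: "v \<noteq> 0" "over (Fq2 q) v" "pt v = pt (P *v nu t)" by (auto simp: PG_def)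
  then obtain k where k: "v = k *s (P *v nu t)" using pt_eqD by blast
  then have "k \<noteq> 0" using v(1) by auto
  have fix_P: "(P $ i $ j ^ q) ^ q = P $ i $ j" for i j
    using P_over Fq_Fq2 by (auto simp: mat_over_def simp flip: Fq2_iff)
  have vP: "v = P *v (k *s nu t)" using k by (simp add: mult_vec_smult)
  have "v = cj (cj v)" using v(2) by (simp add: vec_eq_iff Defs.over_def Fq2_iff)
  also have "\<dots> = P *v cj (cj (k *s nu t))"
    unfolding vP by (simp add: vec_eq_iff matrix_vector_mult_def frob_sum frob_mult fix_P)
  finally have "cj (cj (k *s nu t)) = k *s nu t"
    using mult_vec_cancel[OF det_P] vP by metis
  then have "cj (cj (k *s nu t)) $ 0 = (k *s nu t) $ 0" "cj (cj (k *s nu t)) $ 1 = (k *s nu t) $ 1"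
    by simp_all
  then have "(k ^ q) ^ q = k" "((k * t) ^ q) ^ q = k * t" by (simp_all add: nu_def)
  then show "t \<in> Fq2 q" using \<open>k \<noteq> 0\<close> by (simp add: frob_mult Fq2_iff)
qed

lemma ver_mult_nz: "A *v ver 1 t \<noteq> 0" "cjm A *v ver 1 t \<noteq> 0"
  using mult_vec_eq_0_iff[OF det_A] mult_vec_eq_0_iff[of "cjm A"] det_A
  by (simp_all add: det_cjm ver_eq_0_iff)

text \<open>By \<open>P_eval\<close> the equations read \<open>l l' = 0\<close>,
  \<open>a' l = 0\<close> and \<open>b' l = 0\<close>; as \<open>a', b', l'\<close> never vanish
  together, they amount to \<open>l = 0\<close>.\<close>

lemma P_nu_in_transv_conj_iff:
  "pt (P *v nu t) \<in> transv K (\<tau> ^ q) \<longleftrightarrow> pt (P *v nu t) \<in> PG K \<and> poly (quad (A $ 2)) t = 0"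
  using ver_mult_nz(2)[of t]
  unfolding pt_in_transv_iff quad_eval nu_eq_nuh P_eval vec3_eq_iff by auto

lemma P_nu_in_transv_iff:
  "pt (P *v nu t) \<in> transv K \<tau> \<longleftrightarrow> pt (P *v nu t) \<in> PG K \<and> poly (quad (cj (A $ 2))) t = 0"
  using ver_mult_nz(1)[of t]
  unfolding pt_in_transv_iff cjm_nth[symmetric] quad_eval nu_eq_nuh P_eval vec3_eq_iff by auto

lemma special: "g_special q \<tau> P \<or> gss_special q \<tau> P"
proof -
  obtain r s where l: "quad (A $ 2) = smult (A $ 2 $ 2) ([:- r, 1:] * [:- s, 1:])"
    and l': "quad (cj (A $ 2)) = smult (A $ 2 $ 2 ^ q) ([:- (r ^ q), 1:] * [:- (s ^ q), 1:])"
    and cases: "r \<in> Fq2 q \<and> s \<in> Fq2 q \<or> r \<notin> Fq2 q \<and> s \<notin> Fq2 q \<and> r \<noteq> s"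
    by (rule l_factor)
  have root_l: "poly (quad (A $ 2)) t = 0 \<longleftrightarrow> t \<in> {r, s}" for t
    unfolding l poly_smult poly_mult using lead_nz by auto
  have root_l': "poly (quad (cj (A $ 2))) t = 0 \<longleftrightarrow> t \<in> {r ^ q, s ^ q}" for t
    unfolding l' poly_smult poly_mult using lead_nz by auto
  show ?thesis
  proof (cases "r \<in> Fq2 q")
    case True
    with cases have rs: "{r, s} \<subseteq> Fq2 q" by auto
    have "poly (quad (A $ 2)) t \<noteq> 0 \<or> poly (quad (cj (A $ 2))) t \<noteq> 0" for t
      using no_common_zero[of 1 t] unfolding cjm_nth[symmetric] quad_eval by auto
    then have disj: "{r, s} \<inter> {r ^ q, s ^ q} = {}" unfolding root_l root_l' by blast
    have c: "A $ 2 $ 2 * A $ 2 $ 2 ^ q \<noteq> 0" using lead_nz by simp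
    have "int_mult q P (g_line q \<tau>) = 2"
    proof (rule int_mult_eq_2[OF _ c rs disj])
      show "hpoly P = smult (A $ 2 $ 2 * A $ 2 $ 2 ^ q)
          ([:- r, 1:] * [:- s, 1:] * ([:- (r ^ q), 1:] * [:- (s ^ q), 1:]))"
        unfolding hpoly_P l l'
        by (simp only: mult_smult_left mult_smult_right smult_smult mult.commute[of "A $ 2 $ 2" "A $ 2 $ 2 ^ q"])
    qed (simp only: g_line_def P_nu_in_transv_conj_iff P_nu_in_PG_iff root_l simp_thms)
    moreover have "int_mult q P (gq_line q \<tau>) = 2"
    proof (rule int_mult_eq_2[OF _ c])
      show "hpoly P = smult (A $ 2 $ 2 * A $ 2 $ 2 ^ q)
          ([:- (r ^ q), 1:] * [:- (s ^ q), 1:] * ([:- r, 1:] * [:- s, 1:]))"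
        unfolding hpoly_P l l'
        by (simp only: mult_smult_left mult_smult_right smult_smult mult.commute[of "A $ 2 $ 2" "A $ 2 $ 2 ^ q"]
            mult.commute[of "[:- r, 1:] * [:- s, 1:]" "[:- (r ^ q), 1:] * [:- (s ^ q), 1:]"])
      show "{r ^ q, s ^ q} \<subseteq> Fq2 q" using rs Fq2_frob by auto
      show "{r ^ q, s ^ q} \<inter> {r, s} = {}" using disj by blast
    qed (simp only: gq_line_def P_nu_in_transv_iff P_nu_in_PG_iff root_l' simp_thms)
    ultimately show ?thesis by (simp add: g_special_def)
  next
    case False
    with cases have rs: "r \<notin> Fq2 q" "s \<notin> Fq2 q" "r \<noteq> s" by auto
    \<comment> \<open>Both roots of \<open>l\<close> give points of the extended transversal;
      neither is a point of \<open>g\<close>, since its parameter lies outside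
      \<open>Fq2 q\<close>.\<close>
    have on_g: "pt (P *v nu t) \<in> g_ext q \<tau> - g_line q \<tau>" if "t \<in> {r, s}" for t
      using that rs P_nu_nz
      by (auto simp: g_ext_def g_line_def P_nu_in_transv_conj_iff P_nu_in_PG_iff root_l PG_UNIV_I)
    have "pt (P *v nu r) \<noteq> pt (P *v nu s)"
    proof
      assume "pt (P *v nu r) = pt (P *v nu s)"
      then obtain k where "P *v nu r = P *v (k *s nu s)" using pt_eqD by (metis mult_vec_smult)
      then have "nu r = k *s nu s" by (rule mult_vec_cancel[OF det_P])
      then show False using rs(3) by (simp add: nu_def vec5_eq_iff)
    qed
    then have "gss_special q \<tau> P"
      unfolding gss_special_def using on_g
      by (intro exI[of _ "pt (P *v nu r)"] exI[of _ "pt (P *v nu s)"]) (auto simp: nrc_pts_def)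
    then show ?thesis ..
  qed
qed

lemma conj_ver:
  assumes "{s, t} \<subseteq> Fq q"
  shows "(cjm A *v ver s t) $ i = (A *v ver s t) $ i ^ q"
  using assms by (simp add: mult_vec_3 frob_simps Fq_iff Fq_power[unfolded Fq_iff])

text \<open>For parameters in \<open>Fq q\<close> the value of \<open>l'\<close> is
  \<open>l ^ q\<close>, so coprimality makes \<open>l\<close> nonzero. Dividing by
  \<open>w $ 4 = l * l ^ q\<close> recovers the affine coordinates, whose splitting along
  \<open>1, \<tau>\<close> is unique.\<close>

lemma bb_rel_iff:
  assumes st: "{s, t} \<subseteq> Fq q" "s \<noteq> 0 \<or> t \<noteq> 0"
  shows "bb_rel q \<tau> (pt (A *v ver s t)) R \<longleftrightarrow> R = pt (P *v nuh s t)"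
proof -
  define l where "l = (A *v ver s t) $ 2"
  define w where "w = P *v nuh s t"
  have l0: "l \<noteq> 0" using no_common_zero[of s t] conj_ver[OF st(1)] st(2) by (auto simp: l_def)
  have wK: "w $ i \<in> Fq q" for i
    using P_over nuh_over[OF st(1)]
    by (auto simp: w_def matrix_vector_mult_def mat_over_def intro!: Fq_sum Fq_closed)
  have w: "w $ 0 + w $ 1 * \<tau> = (A *v ver s t) $ 0 * l ^ q"
    "w $ 2 + w $ 3 * \<tau> = (A *v ver s t) $ 1 * l ^ q" "w $ 4 = l * l ^ q"
    unfolding w_def P_eval conj_ver[OF st(1)] l_def by simp_all
  then have w4: "w $ 4 \<noteq> 0" using l0 by simp
  have quotK: "w $ i / w $ 4 \<in> Fq q" for i using wK by (intro Fq_closed)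
  have quot: "w $ 0 / w $ 4 + w $ 1 / w $ 4 * \<tau> = (A *v ver s t) $ 0 / l"
    "w $ 2 / w $ 4 + w $ 3 / w $ 4 * \<tau> = (A *v ver s t) $ 1 / l"
    using w l0 by (simp_all flip: add_divide_distrib)
  have "w = w $ 4 *s vec5 (w $ 0 / w $ 4) (w $ 1 / w $ 4) (w $ 2 / w $ 4) (w $ 3 / w $ 4) 1"
    using w4 by (simp add: vec5_eq_iff)
  then have pt_w: "pt (vec5 (w $ 0 / w $ 4) (w $ 1 / w $ 4) (w $ 2 / w $ 4) (w $ 3 / w $ 4) 1) = pt w"
    using pt_smult[OF w4] by metis
  show ?thesis
    unfolding w_def[symmetric]
  proof
    assume "bb_rel q \<tau> (pt (A *v ver s t)) R"
    then obtain v x0 x1 y0 y1 where v: "pt v = pt (A *v ver s t)" "v $ 2 = 1" "{x0, x1, y0, y1} \<subseteq> Fq q"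
      "v $ 0 = x0 + x1 * \<tau>" "v $ 1 = y0 + y1 * \<tau>" and R: "R = pt (vec5 x0 x1 y0 y1 1)"
      by (auto simp: bb_rel_def)
    obtain k where k: "v = k *s (A *v ver s t)" using pt_eqD[OF v(1)] by blast
    have "k * l = 1" using v(2) k by (simp add: l_def)
    then have "k = 1 / l" using l0 by (simp add: field_simps)
    then have "x0 + x1 * \<tau> = w $ 0 / w $ 4 + w $ 1 / w $ 4 * \<tau>"
      "y0 + y1 * \<tau> = w $ 2 / w $ 4 + w $ 3 / w $ 4 * \<tau>"
      unfolding quot using v(4,5) k by simp_all
    then have "x0 = w $ 0 / w $ 4" "x1 = w $ 1 / w $ 4" "y0 = w $ 2 / w $ 4" "y1 = w $ 3 / w $ 4"
      using coord_unique quotK v(3) by (metis insert_subset)+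
    then show "R = pt w" using R pt_w by simp
  next
    assume "R = pt w"
    then show "bb_rel q \<tau> (pt (A *v ver s t)) R"
      unfolding bb_rel_def using quotK quot l0 pt_w pt_smult[of "1 / l" "A *v ver s t"]
      by (intro exI[of _ "(1 / l) *s (A *v ver s t)"] exI[of _ "w $ 0 / w $ 4"] exI[of _ "w $ 1 / w $ 4"]
          exI[of _ "w $ 2 / w $ 4"] exI[of _ "w $ 3 / w $ 4"]) (simp add: l_def)
  qed
qed

lemma bb_image_eq:
  "bb_image q \<tau> {pt (A *v ver s t) | s t. {s, t} \<subseteq> Fq q \<and> (s \<noteq> 0 \<or> t \<noteq> 0)} = nrc_pts P (Fq q)"
  unfolding bb_image_def nrc_pts_homogeneous using bb_rel_iff by blast

end

lemma bb_image_disjoint_sigma_inf: "bb_image q \<tau> C \<inter> sigma_inf K = {}"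
proof -
  have False if "pt (vec5 x0 x1 y0 y1 1) = pt v" "v $ 4 = 0" for x0 x1 y0 y1 :: 'a and v
    using pt_eqD[OF that(1)] that(2) by (auto simp: vec5_eq_iff)
  then show ?thesis by (force simp: bb_image_def bb_rel_def sigma_inf_def)
qed

section \<open>Tangent Baer subplanes\<close>

definition dot3 :: "'b::semiring_1^3 \<Rightarrow> 'b^3 \<Rightarrow> 'b" where
  "dot3 x z = x $ 0 * z $ 0 + x $ 1 * z $ 1 + x $ 2 * z $ 2"

definition cross :: "'b::ring_1^3 \<Rightarrow> 'b^3 \<Rightarrow> 'b^3" where
  "cross x y = vec3 (x $ 1 * y $ 2 - x $ 2 * y $ 1) (x $ 2 * y $ 0 - x $ 0 * y $ 2) (x $ 0 * y $ 1 - x $ 1 * y $ 0)"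

lemma dot3_cross: "dot3 x (cross x y) = 0" "dot3 y (cross x y) = 0" for x :: "'b::comm_ring_1^3"
  by (simp_all add: dot3_def cross_def algebra_simps)

text \<open>The cross product of \<open>v\<close> with \<open>cross x y\<close> is a combination of
  \<open>x\<close> and \<open>y\<close> with coefficients \<open>dot3 y v\<close> and
  \<open>- dot3 x v\<close>, hence zero, so the two vectors are proportional.\<close>

lemma orthogonal_imp_multiple_of_cross:
  fixes x :: "'b::field^3"
  assumes "cross x y \<noteq> 0" "dot3 x v = 0" "dot3 y v = 0"
  shows "\<exists>k. v = k *s cross x y"
proof -
  define c where "c = cross x y"
  have ratio: "v $ 0 * c $ 1 = v $ 1 * c $ 0" "v $ 0 * c $ 2 = v $ 2 * c $ 0" "v $ 1 * c $ 2 = v $ 2 * c $ 1"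
    using assms(2,3) unfolding c_def cross_def dot3_def vec3_nth by Groebner_Basis.algebra+
  obtain i where i: "c $ i \<noteq> 0" using assms(1) by (auto simp: c_def vec_eq_iff)
  have "\<forall>i j. v $ j * c $ i = v $ i * c $ j"
    by (simp only: forall_3' ratio simp_thms)
  then have "v $ j = v $ i / c $ i * c $ j" for j
    using i by (metis nonzero_eq_divide_eq times_divide_eq_left)
  then have "v = (v $ i / c $ i) *s c" unfolding vec_eq_iff vector_smult_component by blast
  then show ?thesis unfolding c_def by blast
qed

context fq_tower
begin

text \<open>The hypothesis \<open>unique\<close> expresses tangency: the subplane has only one point
  at infinity. If \<open>x\<close> and \<open>y\<close> were dependent, the vectors orthogonal to
  both would form more than one point.\<close>

lemma cross_nz:
  fixes x y :: "'a^3"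
  assumes K: "over (Fq q) x" "over (Fq q) y"
    and unique: "\<And>z z' :: 'a^3. over (Fq q) z \<Longrightarrow> z \<noteq> 0 \<Longrightarrow> dot3 x z = 0 \<Longrightarrow> dot3 y z = 0
      \<Longrightarrow> over (Fq q) z' \<Longrightarrow> z' \<noteq> 0 \<Longrightarrow> dot3 x z' = 0 \<Longrightarrow> dot3 y z' = 0 \<Longrightarrow> \<exists>k. z = k *s z'"
  shows "cross x y \<noteq> 0"
proof
  assume c: "cross x y = 0"
  have "u = 0" if u: "u = x \<or> u = y" for u
  proof -
    have uK: "u $ i \<in> Fq q" for i using u K by (auto simp: Defs.over_def)
    \<comment> \<open>The cross products of \<open>u\<close> with the unit vectors. They are
      orthogonal to \<open>x\<close> and \<open>y\<close>, and a nonzero coordinate of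
      \<open>u\<close> makes two of them independent.\<close>
    define z0 z1 z2 where "z0 = vec3 0 (u $ 2) (- (u $ 1))" and "z1 = vec3 (- (u $ 2)) 0 (u $ 0)"
      and "z2 = vec3 (u $ 1) (- (u $ 0)) 0"
    have over: "over (Fq q) z0" "over (Fq q) z1" "over (Fq q) z2"
      using uK by (auto simp: Defs.over_def forall_3' z0_def z1_def z2_def intro: Fq_minus)
    have orth: "dot3 x z0 = 0" "dot3 x z1 = 0" "dot3 x z2 = 0" "dot3 y z0 = 0" "dot3 y z1 = 0" "dot3 y z2 = 0"
      using c u by (auto simp: dot3_def z0_def z1_def z2_def cross_def vec3_eq_iff algebra_simps)
    have "u $ 0 = 0"
    proof (rule ccontr)
      assume "u $ 0 \<noteq> 0"
      then have "z1 \<noteq> 0" "z2 \<noteq> 0" by (auto simp: z1_def z2_def vec3_eq_iff)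
      then obtain k where "z1 = k *s z2" using unique orth over by blast
      with \<open>u $ 0 \<noteq> 0\<close> show False by (simp add: z1_def z2_def vec3_eq_iff)
    qed
    moreover have "u $ 1 = 0"
    proof (rule ccontr)
      assume "u $ 1 \<noteq> 0"
      then have "z0 \<noteq> 0" "z2 \<noteq> 0" by (auto simp: z0_def z2_def vec3_eq_iff)
      then obtain k where "z0 = k *s z2" using unique orth over by blast
      with \<open>u $ 1 \<noteq> 0\<close> show False by (simp add: z0_def z2_def vec3_eq_iff)
    qed
    moreover have "u $ 2 = 0"
    proof (rule ccontr)
      assume "u $ 2 \<noteq> 0"
      then have "z0 \<noteq> 0" "z1 \<noteq> 0" by (auto simp: z0_def z1_def vec3_eq_iff)
      then obtain k where "z0 = k *s z1" using unique orth over by blast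
      with \<open>u $ 2 \<noteq> 0\<close> show False by (simp add: z0_def z1_def vec3_eq_iff)
    qed
    ultimately show ?thesis by (simp add: vec3_eq_iff)
  qed
  then have "x = 0" "y = 0" by auto
  then have "dot3 x z = 0" "dot3 y z = 0" for z by (simp_all add: dot3_def)
  moreover have "over (Fq q) (vec3 1 0 (0::'a))" "over (Fq q) (vec3 0 1 (0::'a))"
    by (simp_all add: Defs.over_def forall_3')
  moreover have "vec3 1 0 (0::'a) \<noteq> 0" "vec3 0 1 (0::'a) \<noteq> 0" by (simp_all add: vec3_eq_iff)
  ultimately have "\<exists>k. vec3 1 0 0 = k *s vec3 0 1 (0::'a)" by (intro unique)
  then show False by (auto simp: vec3_eq_iff)
qed

lemma qform_smult: "qform a b c d e f (k *s v) = k\<^sup>2 * qform a b c d e f v"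
  by (simp add: qform_def algebra_simps power2_eq_square)

text \<open>Writing the last row of \<open>M\<close> as \<open>x + y \<tau>\<close>, the subplane
  point at infinity comes from \<open>p = cross x y\<close>, and \<open>T \<notin> C\<close> says
  that the form is nonzero at \<open>p\<close>. A common zero of \<open>l\<close> and
  \<open>l'\<close> yields a conic vector orthogonal to \<open>x\<close> and \<open>y\<close>, that
  is a multiple \<open>k *s p\<close>, and so \<open>k = 0\<close>.\<close>

lemma param_conic_of_Fq_conic:
  fixes M :: "'a^3^3"
  assumes M: "mat_over (Fq2 q) M" "det M \<noteq> 0"
    and tangent: "baer_img q M \<inter> line_inf q = {T}"
    and K: "{a, b, c, d, e, f} \<subseteq> Fq q" "qdisc a b c d e f \<noteq> 0"
    and C: "C = {pt (M *v v) | v. v \<noteq> 0 \<and> over (Fq q) v \<and> qform a b c d e f v = 0}"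
    and T: "T \<notin> C"
  obtains A where "param_conic q \<tau> A"
    "C = {pt (A *v ver s t) | s t. {s, t} \<subseteq> Fq q \<and> (s \<noteq> 0 \<or> t \<noteq> 0)}"
proof -
  obtain N where "conic_param N a b c d e f" using conic_param_exists[OF K] by blast
  then have N: "mat_over (Fq q) N" "det N \<noteq> 0" "\<And>s t. qform a b c d e f (N *v ver s t) = 0"
    "\<And>v. over (Fq q) v \<Longrightarrow> v \<noteq> 0 \<Longrightarrow> qform a b c d e f v = 0 \<Longrightarrow>
       \<exists>s t k. {s, t, k} \<subseteq> Fq q \<and> k \<noteq> 0 \<and> v = k *s (N *v ver s t)"
    by (auto simp: conic_param_def)
  define A where "A = M ** N"
  have A_mult: "A *v x = M *v (N *v x)" for x by (simp add: A_def matrix_vector_mul_assoc)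
  define x y where "x = (\<chi> j. fst_coord (M $ 2 $ j))" and "y = (\<chi> j. snd_coord (M $ 2 $ j))"
  have xyK: "over (Fq q) x" "over (Fq q) y"
    using M(1) by (auto simp: Defs.over_def x_def y_def coord_in_Fq mat_over_def)
  have last: "(M *v z) $ 2 = dot3 x z + dot3 y z * \<tau>" for z
  proof -
    have "M $ 2 $ j = x $ j + y $ j * \<tau>" for j by (simp add: x_def y_def coord_sum)
    then show ?thesis by (simp add: mult_vec_3 dot3_def algebra_simps)
  qed
  have at_inf: "pt (M *v z) = T" if z: "over (Fq q) z" "z \<noteq> 0" "dot3 x z = 0" "dot3 y z = 0" for z
  proof -
    have "over (Fq2 q) (M *v z)"
      using M(1) z(1) by (auto simp: Defs.over_def matrix_vector_mult_def mat_over_def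
          intro!: Fq2_sum Fq2_closed intro: Fq_Fq2)
    moreover have "M *v z \<noteq> 0" using mult_vec_eq_0_iff[OF M(2)] z(2) by simp
    moreover have "(M *v z) $ 2 = 0" using z by (simp add: last)
    ultimately have "pt (M *v z) \<in> baer_img q M \<inter> line_inf q"
      using z by (auto simp: baer_img_def line_inf_def PG_def)
    then show ?thesis using tangent by blast
  qed
  define p where "p = cross x y"
  have p: "p \<noteq> 0"
    unfolding p_def
  proof (rule cross_nz[OF xyK])
    fix z z' :: "'a^3"
    assume "over (Fq q) z" "z \<noteq> 0" "dot3 x z = 0" "dot3 y z = 0"
      "over (Fq q) z'" "z' \<noteq> 0" "dot3 x z' = 0" "dot3 y z' = 0"
    then have "pt (M *v z) = pt (M *v z')" using at_inf by simp
    then obtain k where "M *v z = M *v (k *s z')" using pt_eqD by (metis mult_vec_smult)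
    then show "\<exists>k. z = k *s z'" using mult_vec_cancel[OF M(2)] by blast
  qed
  have pK: "over (Fq q) p"
    using xyK by (auto simp: Defs.over_def forall_3' p_def cross_def intro!: Fq_intros)
  have "pt (M *v p) = T" using at_inf[OF pK p] by (simp add: p_def dot3_cross)
  then have Qp: "qform a b c d e f p \<noteq> 0" using T C p pK by blast
  have "param_conic q \<tau> A"
  proof (intro param_conic.intro param_conic_axioms.intro fq_tower_axioms)
    show "mat_over (Fq2 q) A"
      using M(1) N(1) by (auto simp: A_def mat_over_def matrix_matrix_mult_def
          intro!: Fq2_sum Fq2_closed intro: Fq_Fq2)
    show "det A \<noteq> 0" using M(2) N(2) by (simp add: A_def det_mul)
    fix s t
    assume l: "(A *v ver s t) $ 2 = 0" and l': "(cjm A *v ver s t) $ 2 = 0"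
    define v where "v = N *v ver s t"
    have "cj (A $ 2) $ k = (\<Sum>j\<in>UNIV. M $ 2 $ j ^ q * N $ j $ k)" for k
      using N(1) by (simp add: A_def matrix_matrix_mult_def frob_sum frob_mult mat_over_def Fq_iff)
    then have "(cjm A *v ver s t) $ 2 = (\<Sum>j\<in>UNIV. M $ 2 $ j ^ q * v $ j)"
      unfolding mult_vec_3 cjm_nth v_def by (simp add: sum_3' algebra_simps)
    also have "\<dots> = (\<Sum>j\<in>UNIV. (x $ j + y $ j * \<tau> ^ q) * v $ j)"
      by (simp add: x_def y_def coord_sum_conj)
    also have "\<dots> = dot3 x v + dot3 y v * \<tau> ^ q"
      by (simp add: sum_3' dot3_def algebra_simps)
    finally have "dot3 x v + dot3 y v * \<tau> ^ q = 0" using l' by simp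
    moreover have "dot3 x v + dot3 y v * \<tau> = 0"
      using l unfolding A_mult last v_def .
    \<comment> \<open>The parameters lie in the big field, so \<open>dot3 x v\<close> and
      \<open>dot3 y v\<close> need not be in \<open>Fq q\<close>; both vanish because the two
      equations with \<open>\<tau>\<close> and \<open>\<tau> ^ q\<close> are independent.\<close>
    moreover have "dot3 y v * (\<tau> - \<tau> ^ q)
        = (dot3 x v + dot3 y v * \<tau>) - (dot3 x v + dot3 y v * \<tau> ^ q)" by (simp add: algebra_simps)
    ultimately have "dot3 y v * (\<tau> - \<tau> ^ q) = 0" by simp
    then have "dot3 y v = 0" using tau_q by simp
    moreover from this have "dot3 x v = 0" using \<open>dot3 x v + dot3 y v * \<tau> = 0\<close> by simp
    ultimately obtain k where k: "v = k *s p"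
      using orthogonal_imp_multiple_of_cross p unfolding p_def by blast
    then have "k\<^sup>2 * qform a b c d e f p = 0" using N(3)[of s t] by (simp add: v_def qform_smult)
    then have "v = 0" using Qp k by simp
    then show "s = 0 \<and> t = 0"
      using mult_vec_eq_0_iff[OF N(2)] by (simp add: v_def ver_eq_0_iff)
  qed
  moreover have "C = {pt (A *v ver s t) | s t. {s, t} \<subseteq> Fq q \<and> (s \<noteq> 0 \<or> t \<noteq> 0)}"
  proof (intro equalityI subsetI)
    fix R assume "R \<in> C"
    then obtain v where v: "R = pt (M *v v)" "v \<noteq> 0" "over (Fq q) v" "qform a b c d e f v = 0"
      unfolding C by auto
    from N(4)[OF v(3,2,4)] obtain s t k
      where k: "{s, t, k} \<subseteq> Fq q" "k \<noteq> 0" "v = k *s (N *v ver s t)" by blast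
    have "s \<noteq> 0 \<or> t \<noteq> 0" using k(3) v(2) mult_vec_eq_0_iff[OF N(2)] by (auto simp: ver_eq_0_iff)
    moreover have "R = pt (A *v ver s t)" using k(2) unfolding v(1) k(3) A_mult mult_vec_smult
      by (rule pt_smult)
    ultimately show "R \<in> {pt (A *v ver s t) | s t. {s, t} \<subseteq> Fq q \<and> (s \<noteq> 0 \<or> t \<noteq> 0)}" using k(1) by auto
  next
    fix R assume "R \<in> {pt (A *v ver s t) | s t. {s, t} \<subseteq> Fq q \<and> (s \<noteq> 0 \<or> t \<noteq> 0)}"
    then obtain s t where R: "R = pt (M *v (N *v ver s t))" "{s, t} \<subseteq> Fq q" "s \<noteq> 0 \<or> t \<noteq> 0"
      unfolding A_mult by blast
    have "N *v ver s t \<noteq> 0" using mult_vec_eq_0_iff[OF N(2)] R(3) by (auto simp: ver_eq_0_iff)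
    moreover have "over (Fq q) (N *v ver s t)"
      using N(1) R(2) by (auto simp: Defs.over_def mult_vec_3 mat_over_def intro!: Fq_intros)
    ultimately show "R \<in> C" using R N(3) unfolding C by blast
  qed
  ultimately show thesis by (rule that)
qed

end

theorem theorem5p8:
  fixes q :: nat and \<tau> :: "'a::{field,finite}"
    and B C :: "('a^3) set set" and T :: "('a^3) set"
  assumes "CARD('a) = q ^ 4" and "q > 7"
    and "\<tau> \<in> Fq2 q - Fq q"
    and "baer_subplane q B"
    and "B \<inter> line_inf q = {T}"
    and "Fq_conic q C B"
    and "T \<notin> C"
  shows "\<exists>M. is_nrc_matrix q M \<and> bb_image q \<tau> C = nrc_pts M (Fq q)
           \<and> bb_image q \<tau> C \<inter> sigma_inf (Fq q) = {}
           \<and> (g_special q \<tau> M \<or> gss_special q \<tau> M)"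
proof -
  interpret fq_tower q \<tau> using assms(1-3) by unfold_locales auto
  from assms(6) obtain M a b c d e f where M: "mat_over (Fq2 q) M" "det M \<noteq> 0" "B = baer_img q M"
    and K: "{a, b, c, d, e, f} \<subseteq> Fq q" "qdisc a b c d e f \<noteq> 0"
    and C: "C = {pt (M *v v) | v. v \<noteq> 0 \<and> over (Fq q) v \<and> qform a b c d e f v = 0}"
    unfolding Fq_conic_def by blast
  obtain A where A: "param_conic q \<tau> A"
    and C_eq: "C = {pt (A *v ver s t) | s t. {s, t} \<subseteq> Fq q \<and> (s \<noteq> 0 \<or> t \<noteq> 0)}"
    by (rule param_conic_of_Fq_conic[OF M(1,2) assms(5)[unfolded M(3)] K C assms(7)])
  interpret param_conic q \<tau> A by (rule A)
  have "is_nrc_matrix q P" using P_over det_P by (simp add: is_nrc_matrix_def)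
  moreover have "bb_image q \<tau> C = nrc_pts P (Fq q)" unfolding C_eq by (rule bb_image_eq)
  ultimately show ?thesis using special bb_image_disjoint_sigma_inf by blast
qed

end
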